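(* Let $\mathcal E^{(n)}=\big(\mathcal X^{(n)},\mathcal B^{(n)},\{\mathbb P^{(n)}_{\boldsymbol\tau,\eta}:\boldsymbol\tau\in\mathbb R^k,\eta\in\Upsilon\}\big)$, $n\in\mathbb N$, be a sequence of experiments converging weakly, in the Le Cam sense, to the experiment $\mathcal E=\big(\mathcal X,\mathcal B,\{\mathbb P_{\boldsymbol\tau,\eta}:\boldsymbol\tau\in\mathbb R^k,\eta\in\Upsilon\}\big)$, and let $\mathcal E^{(n)}_{\mathbf 0}$ and $\mathcal E_{\mathbf 0}$ be the nuisance subexperiments corresponding to $\boldsymbol\tau=\mathbf 0$. Let the $\sigma$-field $\mathcal B$ in $\mathcal E$ be countably generated. Assume that (i) $\mathcal E_{\mathbf 0}$ admits a minimal sufficient and boundedly complete $\sigma$-field $\mathcal B_{\rm suff}\subseteq\mathcal B$ and a unique maximal ancillary $\sigma$-field $\mathcal B^{\ddagger}\subseteq\mathcal B$ (equivalently, a unique ancillary $\sigma$-field $\mathcal B^{\ddagger}$ such that $\sigma(\mathcal B_{\rm suff}\cup\mathcal B^{\ddagger})=\mathcal B$); (ii) for each $n$, $\mathcal E^{(n)}_{\mathbf 0}$ admits a minimal sufficient and boundedly complete $\sigma$-field $\mathcal B^{(n)}_{\rm suff}\subseteq\mathcal B^{(n)}$ and a (not necessarily unique) maximal ancillary $\sigma$-field $\mathcal B^{\ddagger(n)}\subseteq\mathcal B^{(n)}$ (equivalently, an ancillary $\sigma$-field $\mathcal B^{\ddagger(n)}$ such that $\sigma(\mathcal B^{(n)}_{\rm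 suff}\cup\mathcal B^{\ddagger(n)})=\mathcal B^{(n)}$); (iii) $\mathcal B^{\ddagger(n)}$ converges $\mathcal E^{(n)}$-weakly to $\mathcal B^{\ddagger}$ as $n\to\infty$. Then, for any $l_1,l_2\in\mathbb N$, any $(\boldsymbol\tau_{1},\ldots,\boldsymbol\tau_{l_1})\in\mathbb R^{k\times l_1}$ and any $(\eta_{1},\ldots,\eta_{l_2})\in\Upsilon^{l_2}$, under $\mathbb P^{(n)}_{\mathbf 0,0}$, as $n\to\infty$, $$\left(\mathbb E^{(n)}_{\boldsymbol\tau_i,\eta_j}\left[\frac{\mathrm d\mathbb P^{(n)}_{\boldsymbol\tau_i,\eta_j}}{\mathrm d\mathbb P^{(n)}_{\mathbf 0,0}}\,\Big|\,\mathcal B^{\ddagger(n)}\right]\right)_{1\le i\le l_1,\,1\le j\le l_2}\ \stackrel{\mathcal L}{\longrightarrow}\ \left(\mathbb E_{\boldsymbol\tau_i,\eta_j}\left[\frac{\mathrm d\mathbb P_{\boldsymbol\tau_i,\eta_j}}{\mathrm d\mathbb P_{\mathbf 0,0}}\,\Big|\,\mathcal B^{\ddagger}\right]\right)_{1\le i\le l_1,\,1\le j\le l_2},$$ where the limit is considered under $\mathbb P_{\mathbf 0,0}$, and $\mathbb E^{(n)}_{\boldsymbol\tau,\eta}$, $\mathbb E_{\boldsymbol\tau,\eta}$ stand for expectations under $\mathbb P^{(n)}_{\boldsymbol\tau,\eta}$ and $\mathbb P_{\boldsymbol\tau,\eta}$, respectively.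
   Context: Here $\boldsymbol\tau\in\mathbb R^k$ is the (local) parameter of interest and $\eta$ the (local) nuisance, ranging over a separable infinite-dimensional vector space $\Upsilon$ with origin $0$. Within each experiment, all probability measures are mutually absolutely continuous. $\mathrm d\mathrm P/\mathrm d\mathrm Q$ denotes the Radon-Nikodym derivative of the component of $\mathrm P$ that is absolutely continuous with respect to $\mathrm Q$; $\stackrel{\mathcal L}{\longrightarrow}$ denotes convergence in distribution. Weak (Le Cam) convergence of $\mathcal E^{(n)}$ to $\mathcal E$: for every finite set $J$ of values $(\boldsymbol\tau,\eta)$, the vector $(\mathrm d\mathbb P^{(n)}_{\boldsymbol\tau,\eta}/\mathrm d\mathbb P^{(n)}_{\mathbf 0,0})_{(\boldsymbol\tau,\eta)\in J}$ under $\mathbb P^{(n)}_{\mathbf 0,0}$ converges in distribution to $(\mathrm d\mathbb P_{\boldsymbol\tau,\eta}/\mathrm d\mathbb P_{\mathbf 0,0})_{(\boldsymbol\tau,\eta)\in J}$ under $\mathbb P_{\mathbf 0,0}$. Nuisance subexperiments: $\mathcal E^{(n)}_{\mathbf 0}=(\mathcal X^{(n)},\mathcal B^{(n)},\{\mathbb P^{(n)}_{\mathbf 0,\eta}:\eta\in\Upsilon\})$ and $\mathcal E_{\mathbf 0}=(\mathcal X,\mathcal B,\{\mathbb P_{\mathbf 0,\eta}:\eta\in\Upsilon\})$. In an experiment $(\Omega,\mathcal A,\mathcal P)$, a sub-$\sigma$-field $\mathcal A_0$ is ancillary if $\mathrm P_1(A)=\mathrm P_2(A)$ for all $A\in\mathcal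 A_0$ and all $\mathrm P_1,\mathrm P_2\in\mathcal P$; it is maximal ancillary if it is maximal among ancillary $\sigma$-fields for inclusion up to $\mathcal P$-null sets; uniqueness is up to $\mathcal P$-null sets ($\mathcal P$-null sets are tacitly included in all maximal ancillary $\sigma$-fields). $\mathcal A_0$ is boundedly complete if, for every bounded $\mathcal A_0$-measurable random variable $\zeta$, $\mathbb E_{\mathrm P}\zeta=0$ for all $\mathrm P\in\mathcal P$ implies $\zeta=0$ $\mathrm P$-a.s. for all $\mathrm P\in\mathcal P$. A sequence $\xi_n$ of $\mathcal B^{(n)}$-measurable random variables converges $\mathcal E^{(n)}$-weakly to the $\mathcal B$-measurable random variable $\xi$ if, for every finite set $J$ of values $(\boldsymbol\tau,\eta)$, under $\mathbb P^{(n)}_{\mathbf 0,0}$, $\big((\mathrm d\mathbb P^{(n)}_{\boldsymbol\tau,\eta}/\mathrm d\mathbb P^{(n)}_{\mathbf 0,0})_{(\boldsymbol\tau,\eta)\in J},\,\xi_n\big)\stackrel{\mathcal L}{\longrightarrow}\big((\mathrm d\mathbb P_{\boldsymbol\tau,\eta}/\mathrm d\mathbb P_{\mathbf 0,0})_{(\boldsymbol\tau,\eta)\in J},\,\xi\big)$, the limit being considered under $\mathbb P_{\mathbf 0,0}$. A sequence $\mathcal A^{(n)}$ of sub-$\sigma$-fields of $\mathcal B^{(n)}$ converges $\mathcal E^{(n)}$-weakly to the sub-$\sigma$-field $\mathcal A$ of $\mathcal B$ if, for every $\mathcal A$-measurable random variable $\xi$, there exists a sequence $\xi_n$ of $\mathcal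 A^{(n)}$-measurable random variables converging $\mathcal E^{(n)}$-weakly to $\xi$. A $\sigma$-field is countably generated if it is generated by a countable family of uniformly bounded random variables (typically, indicators).
   Formalization: The conditional expectations of the likelihood ratios are taken under P_{0,0} (both for n and in the limit) instead of P_{τ,η}, for which the claim fails; and B‡ is assumed both maximal ancillary and to satisfy σ(B_suff ∪ B‡)=B, as the two are not equivalent. *)

theory Defs
  imports "HOL-Probability.Probability"
begin

text \<open>
  A measurable space is a value \<open>B\<close> of type \<open>'a measure\<close> of which only \<open>space B\<close> and \<open>sets B\<close>
  matter; sub-\<open>\<sigma>\<close>-fields are represented in the same way, with the library predicate
  \<open>subalgebra\<close> for inclusion.  The members of an experiment are indexed by a whole type \<open>'i\<close>.
  Mutual absolute continuity within an experiment is a standing assumption and hence part of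
  the definition.
\<close>

definition is_experiment :: "'a measure \<Rightarrow> ('i \<Rightarrow> 'a measure) \<Rightarrow> bool" where
  "is_experiment B P \<longleftrightarrow>
     (\<forall>i. prob_space (P i) \<and> sets (P i) = sets B) \<and>
     (\<forall>i j. absolutely_continuous (P i) (P j))"

text \<open>
  \<open>lik_ratio P Q\<close> is dP/dQ.  It is only used inside an experiment, where P is absolutely continuous
  with respect to Q, so that P is its own absolutely continuous component.
  Note the argument order of \<open>RN_deriv\<close>.
\<close>

definition lik_ratio :: "'a measure \<Rightarrow> 'a measure \<Rightarrow> 'a \<Rightarrow> real" where
  "lik_ratio P Q x = enn2real (RN_deriv Q P x)"

text \<open>
  The vector of likelihood ratios indexed by a set \<open>J\<close> of parameter values is a function restricted
  to \<open>J\<close>.  For finite \<open>J\<close>, the functions that are constant outside \<open>J\<close> form, in the product topology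
  of \<open>'i \<Rightarrow> real\<close>, a closed copy of the Euclidean space of real vectors indexed by \<open>J\<close>, onto which
  the whole space retracts.  Bounded continuous test functions on \<open>'i \<Rightarrow> real\<close> therefore
  induce exactly the bounded continuous test functions on that Euclidean space.
\<close>

definition lik_vector :: "('i \<Rightarrow> 'a measure) \<Rightarrow> 'i \<Rightarrow> 'i set \<Rightarrow> 'a \<Rightarrow> 'i \<Rightarrow> real" where
  "lik_vector P o' J x = (\<lambda>i\<in>J. lik_ratio (P i) (P o') x)"

definition converges_in_distribution ::
  "(nat \<Rightarrow> 'b measure) \<Rightarrow> (nat \<Rightarrow> 'b \<Rightarrow> 's::topological_space) \<Rightarrow> 'a measure \<Rightarrow> ('a \<Rightarrow> 's) \<Rightarrow> bool"
where
  "converges_in_distribution Mn Xn M X \<longleftrightarrow>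
     (\<forall>f :: 's \<Rightarrow> real. continuous_on UNIV f \<and> bounded (range f) \<longrightarrow>
        (\<lambda>n. \<integral>x. f (Xn n x) \<partial>Mn n) \<longlonglongrightarrow> (\<integral>x. f (X x) \<partial>M))"

text \<open>
  The sample spaces of a sequence of experiments are subsets \<open>space (Bn n)\<close> of one carrier type, which
  may vary with \<open>n\<close> and be disjoint; the limit experiment lives on a type of its own.
  Below, \<open>o'\<close> is the reference parameter value.
\<close>

definition Le_Cam_converges ::
  "(nat \<Rightarrow> 'i \<Rightarrow> 'b measure) \<Rightarrow> ('i \<Rightarrow> 'a measure) \<Rightarrow> 'i \<Rightarrow> bool" where
  "Le_Cam_converges Pn P o' \<longleftrightarrow>
     (\<forall>J. finite J \<longrightarrow>
        converges_in_distribution (\<lambda>n. Pn n o') (\<lambda>n. lik_vector (Pn n) o' J)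
          (P o') (lik_vector P o' J))"

definition rv_converges_weakly ::
  "(nat \<Rightarrow> 'i \<Rightarrow> 'b measure) \<Rightarrow> ('i \<Rightarrow> 'a measure) \<Rightarrow> 'i \<Rightarrow> (nat \<Rightarrow> 'b \<Rightarrow> real) \<Rightarrow> ('a \<Rightarrow> real) \<Rightarrow> bool"
where
  "rv_converges_weakly Pn P o' \<xi>n \<xi> \<longleftrightarrow>
     (\<forall>J. finite J \<longrightarrow>
        converges_in_distribution (\<lambda>n. Pn n o') (\<lambda>n x. (lik_vector (Pn n) o' J x, \<xi>n n x))
          (P o') (\<lambda>x. (lik_vector P o' J x, \<xi> x)))"

definition sigma_field_converges_weakly ::
  "(nat \<Rightarrow> 'i \<Rightarrow> 'b measure) \<Rightarrow> ('i \<Rightarrow> 'a measure) \<Rightarrow> 'i \<Rightarrow> (nat \<Rightarrow> 'b measure) \<Rightarrow> 'a measure \<Rightarrow> bool"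
where
  "sigma_field_converges_weakly Pn P o' An A \<longleftrightarrow>
     (\<forall>\<xi> \<in> borel_measurable A. \<exists>\<xi>n.
        (\<forall>n. \<xi>n n \<in> borel_measurable (An n)) \<and> rv_converges_weakly Pn P o' \<xi>n \<xi>)"

definition included_mod_null :: "('i \<Rightarrow> 'a measure) \<Rightarrow> 'a measure \<Rightarrow> 'a measure \<Rightarrow> bool" where
  "included_mod_null P F G \<longleftrightarrow>
     (\<forall>A\<in>sets F. \<exists>A'\<in>sets G. \<forall>i. measure (P i) (sym_diff A A') = 0)"

definition ancillary :: "'a measure \<Rightarrow> ('i \<Rightarrow> 'a measure) \<Rightarrow> 'a measure \<Rightarrow> bool" where
  "ancillary B P F \<longleftrightarrow>
     subalgebra B F \<and> (\<forall>A\<in>sets F. \<forall>i j. measure (P i) A = measure (P j) A)"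

text \<open>By convention, a maximal ancillary \<open>\<sigma>\<close>-field contains all null sets of the family.\<close>

definition maximal_ancillary :: "'a measure \<Rightarrow> ('i \<Rightarrow> 'a measure) \<Rightarrow> 'a measure \<Rightarrow> bool" where
  "maximal_ancillary B P F \<longleftrightarrow>
     ancillary B P F \<and>
     {N \<in> sets B. \<forall>i. measure (P i) N = 0} \<subseteq> sets F \<and>
     (\<forall>G. ancillary B P G \<and> included_mod_null P F G \<longrightarrow> included_mod_null P G F)"

definition unique_maximal_ancillary :: "'a measure \<Rightarrow> ('i \<Rightarrow> 'a measure) \<Rightarrow> 'a measure \<Rightarrow> bool" where
  "unique_maximal_ancillary B P F \<longleftrightarrow>
     maximal_ancillary B P F \<and>
     (\<forall>G. maximal_ancillary B P G \<longrightarrow> included_mod_null P F G \<and> included_mod_null P G F)"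

text \<open>One version of the conditional probability of each event serves all members of the family.\<close>

definition sufficient :: "'a measure \<Rightarrow> ('i \<Rightarrow> 'a measure) \<Rightarrow> 'a measure \<Rightarrow> bool" where
  "sufficient B P S \<longleftrightarrow>
     subalgebra B S \<and>
     (\<forall>A\<in>sets B. \<exists>f \<in> borel_measurable S. \<forall>i. AE x in P i.
        real_cond_exp (P i) S (indicator A) x = f x)"

definition minimal_sufficient :: "'a measure \<Rightarrow> ('i \<Rightarrow> 'a measure) \<Rightarrow> 'a measure \<Rightarrow> bool" where
  "minimal_sufficient B P S \<longleftrightarrow>
     sufficient B P S \<and> (\<forall>G. sufficient B P G \<longrightarrow> included_mod_null P S G)"

definition boundedly_complete :: "'a measure \<Rightarrow> ('i \<Rightarrow> 'a measure) \<Rightarrow> 'a measure \<Rightarrow> bool" where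
  "boundedly_complete B P S \<longleftrightarrow>
     subalgebra B S \<and>
     (\<forall>\<zeta> :: 'a \<Rightarrow> real. \<zeta> \<in> borel_measurable S \<and> (\<exists>C. \<forall>x\<in>space B. \<bar>\<zeta> x\<bar> \<le> C) \<and>
        (\<forall>i. (\<integral>x. \<zeta> x \<partial>P i) = 0) \<longrightarrow> (\<forall>i. AE x in P i. \<zeta> x = 0))"

definition jointly_generate :: "'a measure \<Rightarrow> 'a measure \<Rightarrow> 'a measure \<Rightarrow> bool" where
  "jointly_generate B S F \<longleftrightarrow> sigma_sets (space B) (sets S \<union> sets F) = sets B"

definition countably_generated :: "'a measure \<Rightarrow> bool" where
  "countably_generated B \<longleftrightarrow>
     (\<exists>(Z :: nat \<Rightarrow> 'a \<Rightarrow> real) C.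
        (\<forall>m. \<forall>x\<in>space B. \<bar>Z m x\<bar> \<le> C) \<and>
        sets B = sigma_sets (space B) (\<Union>m. {Z m -` U \<inter> space B | U. U \<in> sets borel}))"

text \<open>
  The conditional expectation, given \<open>F\<close>, of dP/dQ is taken under the reference measure Q: this is
  the likelihood ratio of P to Q for the experiment restricted to \<open>F\<close>, and dP/dQ always has
  expectation one under Q.  Under P itself, dP/dQ need not be integrable, and its conditional
  expectation is not continuous for weak convergence of experiments: on a two-point space with the
  trivial \<open>F\<close>, let Q = (1 - 1/n, 1/n) and P = (1 - q, q) with q the inverse square root of n; then
  dP/dQ converges to 1 in Q-probability, but its expectation under P converges to 2.
\<close>

definition cond_lik_ratio :: "'a measure \<Rightarrow> 'a measure \<Rightarrow> 'a measure \<Rightarrow> 'a \<Rightarrow> real" where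
  "cond_lik_ratio P Q F = real_cond_exp Q F (lik_ratio P Q)"

end

theory Submission
  imports Defs
begin

text \<open>
  Write \<open>Q\<close> for the reference measure.  By Basu's theorem the ancillary \<open>\<sigma>\<close>-field is \<open>Q\<close>-independent of
  the nuisance likelihood ratios \<open>R\<close>, both before and in the limit.  In the limit these ratios and
  \<open>D\<close> generate everything up to null sets, so a likelihood ratio \<open>L\<close> is \<open>L\<^sup>1\<close>-close to a finite sum of
  products \<open>\<Phi>(R) 1\<^sub>A\<close> with \<open>\<Phi>\<close> bounded and continuous and \<open>A\<close> in \<open>D\<close>; all these events \<open>A\<close> are
  functions \<open>\<psi>\<^sub>A(\<xi>)\<close> of one \<open>D\<close>-measurable \<open>\<xi>\<close>.  Let \<open>\<xi>\<^sub>n\<close> converge weakly to \<open>\<xi>\<close>.  Joint convergence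
  with the likelihood ratios, all of expectation one, transfers the approximation to \<open>L\<^sub>n\<close>, and
  independence turns the conditional expectation of the approximant into the sum of
  \<open>E[\<Phi>(R\<^sub>n)] \<psi>\<^sub>A(\<xi>\<^sub>n)\<close>, a continuous function of \<open>\<xi>\<^sub>n\<close> whose coefficients converge.  Without this
  independence the \<open>n\<close>-th ancillary \<open>\<sigma>\<close>-fields could asymptotically carry more information than \<open>D\<close>.
\<close>

subsection \<open>Likelihood ratios\<close>

text \<open>Weak convergence of \<sigma>-fields attaches to each \<open>\<xi>\<close> its own
  sequence and says nothing about two such sequences jointly; hence the detour through a single
  finite-valued variable. Weak convergence of experiments sees only bounded continuous functions of
  finitely many ratios. A likelihood ratio has merely a first moment, so it is truncated before its
  distance to the approximant can act as a test function. The part cut off is nonnegative, and its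
  mean is one minus the truncated mean; convergence of one more bounded expectation therefore does
  the work of uniform integrability. All errors are measured in mean under the reference measure:
  conditioning does not increase them, and the unit first moments supply the tightness that turns
  errors in mean into errors of expectations of test functions.\<close>

lemma lik_ratio_measurable [measurable]: "lik_ratio P Q \<in> borel_measurable Q"
  unfolding lik_ratio_def[abs_def] by measurable

lemma lik_ratio_nonneg [simp]: "0 \<le> lik_ratio P Q x"
  by (simp add: lik_ratio_def)

lemma density_lik_ratio:
  assumes "prob_space P" "prob_space Q" "sets P = sets Q" "absolutely_continuous Q P"
  shows "density Q (lik_ratio P Q) = P"
proof -
  interpret P: prob_space P by fact
  interpret Q: prob_space Q by fact
  have "AE x in Q. RN_deriv Q P x \<noteq> \<infinity>"
    by (rule Q.RN_deriv_finite) (use assms P.sigma_finite_measure_axioms in auto)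
  hence "AE x in Q. ennreal (lik_ratio P Q x) = RN_deriv Q P x"
    by eventually_elim (simp add: lik_ratio_def less_top)
  hence "density Q (lik_ratio P Q) = density Q (RN_deriv Q P)"
    by (intro density_cong) auto
  also have "\<dots> = P" by (rule Q.density_RN_deriv) (use assms in auto)
  finally show ?thesis .
qed

locale stat_experiment =
  fixes B :: "'a measure" and P :: "'i \<Rightarrow> 'a measure"
  assumes exper: "is_experiment B P"
begin

lemma prob_space_P: "prob_space (P i)"
  using exper by (simp add: is_experiment_def)

lemma sets_P [simp, measurable_cong]: "sets (P i) = sets B"
  using exper by (simp add: is_experiment_def)

lemma space_P [simp]: "space (P i) = space B"
  by (rule sets_eq_imp_space_eq) simp

lemma density_lik: "density (P j) (lik_ratio (P i) (P j)) = P i"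
  by (rule density_lik_ratio)
    (use exper in \<open>auto simp: is_experiment_def\<close>)

lemma lik_ratio_meas [measurable]: "lik_ratio (P i) (P j) \<in> borel_measurable B"
  using lik_ratio_measurable[of "P i" "P j"] by (simp cong: measurable_cong_sets)

lemma integral_lik:
  fixes f :: "'a \<Rightarrow> real"
  assumes [measurable]: "f \<in> borel_measurable B"
  shows "(\<integral>x. f x \<partial>P i) = (\<integral>x. f x * lik_ratio (P i) (P j) x \<partial>P j)"
  by (subst density_lik[of j i, symmetric], subst integral_density) (auto simp: mult.commute)

lemma integrable_lik_iff:
  fixes f :: "'a \<Rightarrow> real"
  assumes [measurable]: "f \<in> borel_measurable B"
  shows "integrable (P i) f \<longleftrightarrow> integrable (P j) (\<lambda>x. f x * lik_ratio (P i) (P j) x)"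
  by (subst density_lik[of j i, symmetric], subst integrable_density) (auto simp: mult.commute)

lemma integrable_lik: "integrable (P j) (lik_ratio (P i) (P j))"
proof -
  interpret prob_space "P i" by (rule prob_space_P)
  show ?thesis using integrable_lik_iff[of "\<lambda>_. 1" i j] by simp
qed

lemma integral_lik_1: "(\<integral>x. lik_ratio (P i) (P j) x \<partial>P j) = 1"
proof -
  interpret prob_space "P i" by (rule prob_space_P)
  show ?thesis using integral_lik[of "\<lambda>_. 1" i j] prob_space by simp
qed

lemma subalg_P: "subalgebra B F \<Longrightarrow> subalgebra (P i) F"
  by (simp add: subalgebra_def)

lemma finite_measure_subalgebra_P:
  "subalgebra B F \<Longrightarrow> finite_measure_subalgebra (P i) F"
  using prob_space_P[of i] subalg_P[of F i]
  by (simp add: finite_measure_subalgebra_def finite_measure_subalgebra_axioms_def prob_space_def)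

text \<open>This makes every result about experiments available for the nuisance
  subexperiment.\<close>

lemma experiment_subfamily: "stat_experiment B (\<lambda>j. P (\<nu> j))"
  using exper by (simp add: stat_experiment_def is_experiment_def)

text \<open>Since the indicator is bounded, integrability of \<open>g\<close> is enough. Boundedness
  would be too much to ask: \<open>g\<close> will also be a conditional expectation of a likelihood
  ratio.\<close>

lemma integral_cond_exp_eq:
  assumes F: "subalgebra B F" and [measurable]: "f \<in> borel_measurable F" and "A \<in> sets B"
    and f: "AE x in P i. real_cond_exp (P i) F (indicator A) x = f x"
    and [measurable]: "g \<in> borel_measurable F" and g: "integrable (P i) g"
  shows "(\<integral>x. g x * f x \<partial>P i) = (\<integral>x. g x * indicator A x \<partial>P i)"
    and "integrable (P i) (\<lambda>x. g x * f x)"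
proof -
  interpret finite_measure_subalgebra "P i" F by (rule finite_measure_subalgebra_P[OF F])
  have fB [measurable]: "f \<in> borel_measurable (P i)" "g \<in> borel_measurable (P i)"
    by (rule measurable_from_subalg[OF subalg]; fact)+
  have A[measurable]: "A \<in> sets (P i)" using \<open>A \<in> sets B\<close> by simp
  have int: "integrable (P i) (\<lambda>x. g x * indicator A x)"
    using integrable_real_mult_indicator[OF A g] by (simp add: mult.commute)
  have *: "AE x in P i. g x * real_cond_exp (P i) F (indicator A) x = g x * f x"
    using f by eventually_elim simp
  have "(\<integral>x. g x * real_cond_exp (P i) F (indicator A) x \<partial>P i) = (\<integral>x. g x * indicator A x \<partial>P i)"
    "integrable (P i) (\<lambda>x. g x * real_cond_exp (P i) F (indicator A) x)"
    by (rule real_cond_exp_intg[OF int]; measurable)+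
  moreover have "(\<integral>x. g x * real_cond_exp (P i) F (indicator A) x \<partial>P i) = (\<integral>x. g x * f x \<partial>P i)"
    by (rule integral_cong_AE[OF _ _ *]) auto
  moreover have "integrable (P i) (\<lambda>x. g x * real_cond_exp (P i) F (indicator A) x) = integrable (P i) (\<lambda>x. g x * f x)"
    by (rule integrable_cong_AE[OF _ _ *]) auto
  ultimately show "(\<integral>x. g x * f x \<partial>P i) = (\<integral>x. g x * indicator A x \<partial>P i)"
    "integrable (P i) (\<lambda>x. g x * f x)" by auto
qed

lemma integral_cond_prob:
  assumes F: "subalgebra B F" and f: "f \<in> borel_measurable F" and A: "A \<in> sets B"
    and ce: "AE x in P i. real_cond_exp (P i) F (indicator A) x = f x"
  shows "(\<integral>x. f x \<partial>P i) = measure (P i) A" and "integrable (P i) f"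
proof -
  interpret prob_space "P i" by (rule prob_space_P)
  have 1: "integrable (P i) (\<lambda>_. 1 :: real)" by simp
  note * = integral_cond_exp_eq[OF F f A ce measurable_const 1]
  have "(\<integral>x. f x \<partial>P i) = (\<integral>x. indicator A x \<partial>P i)"
    using *(1) by simp
  also have "\<dots> = measure (P i) A"
    using A by (simp add: sets.Int_space_eq2)
  finally show "(\<integral>x. f x \<partial>P i) = measure (P i) A" .
  show "integrable (P i) f" using *(2) by simp
qed

text \<open>One half of the factorization criterion. The conditional expectation \<open>?r\<close>
  of the ratio has the right integrals over events of \<open>S\<close> by definition. Sufficiency
  extends this to every event \<open>A\<close>: the same \<open>f\<close> is the conditional
  probability of \<open>A\<close> under both \<open>P i\<close> and \<open>P j\<close>, and under
  \<open>P j\<close> the \<open>S\<close>-measurable \<open>f\<close> does not distinguish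
  \<open>?L\<close> from \<open>?r\<close>.\<close>

lemma sufficient_lik_ratio:
  assumes "sufficient B P S"
  shows "\<exists>r\<in>borel_measurable S. AE x in P j. lik_ratio (P i) (P j) x = r x"
proof -
  have S: "subalgebra B S" using assms by (simp add: sufficient_def)
  interpret S: finite_measure_subalgebra "P j" S by (rule finite_measure_subalgebra_P[OF S])
  let ?L = "lik_ratio (P i) (P j)"
  let ?r = "real_cond_exp (P j) S ?L"
  have r: "integrable (P j) ?r" by (rule S.real_cond_exp_int(1)[OF integrable_lik])
  have "AE x in P j. ?L x = ?r x"
  proof (rule density_unique_real[OF integrable_lik r])
    fix A assume "A \<in> sets (P j)"
    hence A [measurable]: "A \<in> sets B" by simp
    obtain f where fS [measurable]: "f \<in> borel_measurable S"
      and f: "\<And>k. AE x in P k. real_cond_exp (P k) S (indicator A) x = f x"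
      using assms A unfolding sufficient_def by blast
    have [measurable]: "f \<in> borel_measurable B"
      by (rule measurable_from_subalg[OF S fS])
    interpret Pi: prob_space "P i" by (rule prob_space_P)
    have "(\<integral>x\<in>A. ?L x \<partial>P j) = (\<integral>x. indicator A x \<partial>P i)"
      by (subst integral_lik[where j = j]) (auto simp: set_lebesgue_integral_def)
    also have "\<dots> = (\<integral>x. f x \<partial>P i)"
      using integral_cond_prob(1)[OF S fS A f[of i]] A by (simp add: sets.Int_space_eq2)
    also have "\<dots> = (\<integral>x. f x * ?L x \<partial>P j)" by (rule integral_lik) measurable
    also have "\<dots> = (\<integral>x. f x * ?r x \<partial>P j)"
    proof (rule S.real_cond_exp_intg(2)[symmetric])
      have "integrable (P i) (\<lambda>x. f x)"
        using integral_cond_prob(2)[OF S fS A f[of i]] by simp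
      thus "integrable (P j) (\<lambda>x. f x * ?L x)"
        by (subst (asm) integrable_lik_iff[where j = j]) auto
    qed measurable
    also have "\<dots> = (\<integral>x. ?r x * indicator A x \<partial>P j)"
      using integral_cond_exp_eq(1)[OF S fS A f[of j] borel_measurable_cond_exp r] by (simp add: mult.commute)
    also have "\<dots> = (\<integral>x\<in>A. ?r x \<partial>P j)"
      by (simp add: set_lebesgue_integral_def mult.commute)
    finally show "(\<integral>x\<in>A. ?L x \<partial>P j) = (\<integral>x\<in>A. ?r x \<partial>P j)" .
  qed
  thus ?thesis by (intro bexI[of _ ?r]) auto
qed

text \<open>Basu's theorem: the conditional probability of an ancillary event given the complete
  sufficient \<open>\<sigma>\<close>-field is constant.\<close>

lemma basu:
  assumes "sufficient B P S" "boundedly_complete B P S" "ancillary B P D"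
    and A: "A \<in> sets D" and g [measurable]: "g \<in> borel_measurable S" and int: "integrable (P i) g"
  shows "(\<integral>x. g x * indicator A x \<partial>P i) = (\<integral>x. g x \<partial>P i) * measure (P i) A"
proof -
  have S: "subalgebra B S" and D: "subalgebra B D"
    using assms by (auto simp: sufficient_def ancillary_def)
  have [measurable]: "A \<in> sets B" using D A by (auto simp: subalgebra_def)
  obtain f where f [measurable]: "f \<in> borel_measurable S"
    and ce: "\<And>k. AE x in P k. real_cond_exp (P k) S (indicator A) x = f x"
    using assms(1) \<open>A \<in> sets B\<close> unfolding sufficient_def by blast
  have [measurable]: "f \<in> borel_measurable B" "g \<in> borel_measurable B"
    by (rule measurable_from_subalg[OF S]; fact)+
  have f01: "AE x in P k. 0 \<le> f x \<and> f x \<le> 1" for k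
  proof -
    interpret finite_measure_subalgebra "P k" S by (rule finite_measure_subalgebra_P[OF S])
    have "AE x in P k. real_cond_exp (P k) S (indicator A) x \<ge> 0"
      by (rule real_cond_exp_ge_c) (auto simp: integrable_real_indicator emeasure_eq_measure)
    moreover have "AE x in P k. real_cond_exp (P k) S (indicator A) x \<le> 1"
      by (rule real_cond_exp_le_c) (auto simp: indicator_def integrable_real_indicator emeasure_eq_measure)
    ultimately show ?thesis using ce[of k] by eventually_elim simp
  qed
  define c where "c = measure (P i) A"
  \<comment> \<open>Bounded completeness asks for a bound at every point, while \<open>f\<close>
    lies in the unit interval only almost everywhere; hence the clipping.\<close>
  define \<zeta> where "\<zeta> x = max 0 (min 1 (f x)) - c" for x
  have \<zeta>f: "AE x in P k. \<zeta> x = f x - c" for k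
    using f01[of k] by eventually_elim (simp add: \<zeta>_def)
  have [measurable]: "\<zeta> \<in> borel_measurable S" unfolding \<zeta>_def by measurable
  have [measurable]: "\<zeta> \<in> borel_measurable B"
    by (rule measurable_from_subalg[OF S]; fact)
  have "(\<integral>x. \<zeta> x \<partial>P k) = 0" for k
  proof -
    interpret prob_space "P k" by (rule prob_space_P)
    note 1 = integral_cond_prob[OF S f \<open>A \<in> sets B\<close> ce]
    have "(\<integral>x. \<zeta> x \<partial>P k) = (\<integral>x. f x - c \<partial>P k)"
      by (rule integral_cong_AE) (use \<zeta>f in auto)
    also have "\<dots> = measure (P k) A - c" using 1 prob_space by simp
    also have "\<dots> = 0" using assms(3) A unfolding ancillary_def c_def by auto
    finally show ?thesis .
  qed
  moreover have "\<bar>\<zeta> x\<bar> \<le> 1 + \<bar>c\<bar>" for x by (auto simp: \<zeta>_def)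
  ultimately have "AE x in P i. \<zeta> x = 0"
    using assms(2) \<open>\<zeta> \<in> borel_measurable S\<close> unfolding boundedly_complete_def by blast
  hence fc: "AE x in P i. f x = c" using \<zeta>f[of i] by eventually_elim simp
  have "(\<integral>x. g x * indicator A x \<partial>P i) = (\<integral>x. g x * f x \<partial>P i)"
    using integral_cond_exp_eq(1)[OF S f \<open>A \<in> sets B\<close> ce[of i] g int] by simp
  also have "\<dots> = (\<integral>x. g x * c \<partial>P i)"
    by (rule integral_cong_AE) (use fc in auto)
  finally show ?thesis by (simp add: c_def)
qed

end

subsection \<open>Cylinder functions of nuisance likelihood ratios\<close>

text \<open>The algebra generated by bounded continuous functions of single coordinates in
  \<open>N\<close>. Closure under products is needed for approximation, and the inductive form
  yields continuity, bounds, finite dependence and \<open>S\<close>-measurable versions by the same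
  induction. \<open>N\<close> will be the set of nuisance parameters, the only ones whose ratios
  Basu's theorem makes independent of \<open>D\<close>.\<close>

inductive cyl :: "'i set \<Rightarrow> (('i \<Rightarrow> real) \<Rightarrow> real) \<Rightarrow> bool" for N where
  cyl_coord: "i \<in> N \<Longrightarrow> continuous_on UNIV h \<Longrightarrow> bounded (range h) \<Longrightarrow> cyl N (\<lambda>u. h (u i))"
| cyl_const: "cyl N (\<lambda>_. c)"
| cyl_add: "cyl N \<Phi> \<Longrightarrow> cyl N \<Psi> \<Longrightarrow> cyl N (\<lambda>u. \<Phi> u + \<Psi> u)"
| cyl_mult: "cyl N \<Phi> \<Longrightarrow> cyl N \<Psi> \<Longrightarrow> cyl N (\<lambda>u. \<Phi> u * \<Psi> u)"

lemma cyl_continuous: "cyl N \<Phi> \<Longrightarrow> continuous_on UNIV \<Phi>"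
proof (induction rule: cyl.induct)
  case (cyl_coord i h)
  show ?case
    by (rule continuous_on_compose2[OF cyl_coord(2) continuous_on_product_coordinates]) auto
qed (auto intro: continuous_intros)

lemma cyl_bounded: "cyl N \<Phi> \<Longrightarrow> \<exists>C. \<forall>u. \<bar>\<Phi> u\<bar> \<le> C"
proof (induction rule: cyl.induct)
  case (cyl_coord i h)
  then obtain C where "\<And>y. \<bar>h y\<bar> \<le> C" by (auto simp: bounded_iff)
  thus ?case by blast
next
  case (cyl_add \<Phi> \<Psi>)
  then obtain C C' where "\<And>u. \<bar>\<Phi> u\<bar> \<le> C" "\<And>u. \<bar>\<Psi> u\<bar> \<le> C'" by blast
  hence "\<bar>\<Phi> u + \<Psi> u\<bar> \<le> C + C'" for u by (meson abs_triangle_ineq add_mono order_trans)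
  thus ?case by blast
next
  case (cyl_mult \<Phi> \<Psi>)
  then obtain C C' where "\<And>u. \<bar>\<Phi> u\<bar> \<le> C" "\<And>u. \<bar>\<Psi> u\<bar> \<le> C'" by blast
  hence "\<bar>\<Phi> u * \<Psi> u\<bar> \<le> C * C'" for u
    unfolding abs_mult by (intro mult_mono) (auto intro: order_trans[OF abs_ge_zero])
  thus ?case by blast
qed auto

text \<open>These coordinates will form the finite set \<open>J\<close> in the definition of weak
  convergence.\<close>

lemma cyl_finite_support:
  "cyl N \<Phi> \<Longrightarrow> \<exists>J. finite J \<and> (\<forall>u v. (\<forall>i\<in>J. u i = v i) \<longrightarrow> \<Phi> u = \<Phi> v)"
proof (induction rule: cyl.induct)
  case (cyl_coord i h)
  show ?case by (rule exI[of _ "{i}"]) auto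
next
  case (cyl_add \<Phi> \<Psi>)
  then obtain J J' where "finite J" "finite J'" "\<And>u v. (\<forall>i\<in>J. u i = v i) \<Longrightarrow> \<Phi> u = \<Phi> v"
    "\<And>u v. (\<forall>i\<in>J'. u i = v i) \<Longrightarrow> \<Psi> u = \<Psi> v" by blast
  thus ?case by (intro exI[of _ "J \<union> J'"]) (auto intro!: arg_cong2[where f = plus])
next
  case (cyl_mult \<Phi> \<Psi>)
  then obtain J J' where "finite J" "finite J'" "\<And>u v. (\<forall>i\<in>J. u i = v i) \<Longrightarrow> \<Phi> u = \<Phi> v"
    "\<And>u v. (\<forall>i\<in>J'. u i = v i) \<Longrightarrow> \<Psi> u = \<Psi> v" by blast
  thus ?case by (intro exI[of _ "J \<union> J'"]) (auto intro!: arg_cong2[where f = times])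
qed auto

text \<open>The induction works coordinate by coordinate: over an uncountable index type the Borel
  \<sigma>-field of the product topology is larger than the one generated by the coordinates, so
  measurable coordinates do not make \<open>R\<close> Borel measurable as a whole.\<close>

lemma cyl_measurable:
  "cyl N \<Phi> \<Longrightarrow> (\<And>i. (\<lambda>x. R x i) \<in> borel_measurable M) \<Longrightarrow> (\<lambda>x. \<Phi> (R x)) \<in> borel_measurable M"
proof (induction rule: cyl.induct)
  case (cyl_coord i h)
  have "h \<in> borel_measurable borel" using cyl_coord(2) by (rule borel_measurable_continuous_onI)
  with cyl_coord(4) show ?case by (rule measurable_compose)
qed auto

text \<open>The functions \<open>\<Phi>\<close> and events \<open>A\<close> are evaluated only through \<open>c\<close> and \<open>a\<close>, so that one list describes
  corresponding random variables in the limit experiment and along the sequence.\<close>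

definition tensor_sum :: "('f \<Rightarrow> real) \<Rightarrow> ('s \<Rightarrow> real) \<Rightarrow> ('f \<times> 's) list \<Rightarrow> real" where
  "tensor_sum c a xs = (\<Sum>(\<Phi>, A)\<leftarrow>xs. c \<Phi> * a A)"

lemma tensor_sum_simps [simp]:
  "tensor_sum c a [] = 0"
  "tensor_sum c a ((\<Phi>, A) # xs) = c \<Phi> * a A + tensor_sum c a xs"
  "tensor_sum c a (xs @ ys) = tensor_sum c a xs + tensor_sum c a ys"
  by (simp_all add: tensor_sum_def)

lemma tensor_sum_cong:
  "(\<And>\<Phi> A. (\<Phi>, A) \<in> set xs \<Longrightarrow> c \<Phi> * a A = c' \<Phi> * a' A) \<Longrightarrow> tensor_sum c a xs = tensor_sum c' a' xs"
  unfolding tensor_sum_def by (intro arg_cong[where f = sum_list] map_cong) auto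

lemma tensor_sum_closure:
  assumes "Q (\<lambda>_. 0)"
    and "\<And>\<Phi> A f. (\<Phi>, A) \<in> set xs \<Longrightarrow> Q f \<Longrightarrow> Q (\<lambda>x. c x \<Phi> * a x A + f x)"
  shows "Q (\<lambda>x. tensor_sum (c x) (a x) xs)"
  using assms(2)
proof (induction xs)
  case (Cons y xs)
  obtain \<Phi> A where y: "y = (\<Phi>, A)" by force
  have "Q (\<lambda>x. tensor_sum (c x) (a x) xs)" by (rule Cons.IH) (rule Cons.prems; simp)
  from Cons.prems[OF _ this, of \<Phi> A] show ?case by (simp add: y)
qed (simp add: assms(1))

lemma continuous_on_tensor_sum:
  fixes c :: "'x :: topological_space \<Rightarrow> 'f \<Rightarrow> real" and a :: "'x \<Rightarrow> 's \<Rightarrow> real"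
  assumes "\<And>\<Phi> A. (\<Phi>, A) \<in> set xs \<Longrightarrow> continuous_on X (\<lambda>x. c x \<Phi>)"
    and "\<And>\<Phi> A. (\<Phi>, A) \<in> set xs \<Longrightarrow> continuous_on X (\<lambda>x. a x A)"
  shows "continuous_on X (\<lambda>x. tensor_sum (c x) (a x) xs)"
  using assms by (intro tensor_sum_closure[where Q = "continuous_on X"] continuous_intros)

lemma measurable_tensor_sum:
  assumes "\<And>\<Phi> A. (\<Phi>, A) \<in> set xs \<Longrightarrow> (\<lambda>x. c x \<Phi>) \<in> borel_measurable M"
    and "\<And>\<Phi> A. (\<Phi>, A) \<in> set xs \<Longrightarrow> (\<lambda>x. a x A) \<in> borel_measurable M"
  shows "(\<lambda>x. tensor_sum (c x) (a x) xs) \<in> borel_measurable M"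
  using assms by (intro tensor_sum_closure[where Q = "\<lambda>f. f \<in> borel_measurable M"] borel_measurable_add
    borel_measurable_times borel_measurable_const)

lemma tendsto_tensor_sum:
  assumes "\<And>\<Phi> A. (\<Phi>, A) \<in> set xs \<Longrightarrow> ((\<lambda>n. c n \<Phi>) \<longlongrightarrow> c' \<Phi>) F"
    and "\<And>\<Phi> A. (\<Phi>, A) \<in> set xs \<Longrightarrow> ((\<lambda>n. a n A) \<longlongrightarrow> a' A) F"
  shows "((\<lambda>n. tensor_sum (c n) (a n) xs) \<longlongrightarrow> tensor_sum c' a' xs) F"
  using assms
proof (induction xs)
  case (Cons y xs)
  obtain \<Phi> A where y: "y = (\<Phi>, A)" by force
  have "((\<lambda>n. tensor_sum (c n) (a n) xs) \<longlongrightarrow> tensor_sum c' a' xs) F"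
  proof (rule Cons.IH)
    fix \<Phi> A assume "(\<Phi>, A) \<in> set xs"
    thus "((\<lambda>n. c n \<Phi>) \<longlongrightarrow> c' \<Phi>) F" "((\<lambda>n. a n A) \<longlongrightarrow> a' A) F"
      using Cons.prems[of \<Phi> A] by auto
  qed
  thus ?case using Cons.prems[of \<Phi> A] unfolding y by (auto intro!: tendsto_intros)
qed simp

lemma tensor_sum_bounded:
  assumes "\<And>\<Phi> A. (\<Phi>, A) \<in> set xs \<Longrightarrow> (\<exists>C. \<forall>x\<in>X. \<bar>c x \<Phi>\<bar> \<le> C) \<and> (\<exists>C. \<forall>x\<in>X. \<bar>a x A\<bar> \<le> C)"
  shows "\<exists>C. \<forall>x\<in>X. \<bar>tensor_sum (c x) (a x) xs\<bar> \<le> C"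
  using assms
proof (induction xs)
  case (Cons y xs)
  obtain \<Phi> A where y: "y = (\<Phi>, A)" by force
  have "\<exists>C. \<forall>x\<in>X. \<bar>tensor_sum (c x) (a x) xs\<bar> \<le> C"
    by (rule Cons.IH, rule Cons.prems) simp
  moreover have "(\<exists>C. \<forall>x\<in>X. \<bar>c x \<Phi>\<bar> \<le> C) \<and> (\<exists>C. \<forall>x\<in>X. \<bar>a x A\<bar> \<le> C)"
    by (rule Cons.prems) (simp add: y)
  ultimately obtain C1 C2 C3 where C: "\<And>x. x \<in> X \<Longrightarrow> \<bar>c x \<Phi>\<bar> \<le> C1"
    "\<And>x. x \<in> X \<Longrightarrow> \<bar>a x A\<bar> \<le> C2" "\<And>x. x \<in> X \<Longrightarrow> \<bar>tensor_sum (c x) (a x) xs\<bar> \<le> C3"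
    by blast
  have "\<bar>tensor_sum (c x) (a x) (y # xs)\<bar> \<le> C1 * C2 + C3" if "x \<in> X" for x
  proof -
    have "\<bar>c x \<Phi> * a x A\<bar> \<le> C1 * C2"
      unfolding abs_mult using C[OF that] by (intro mult_mono) auto
    with C(3)[OF that] show ?thesis by (simp add: y)
  qed
  thus ?case by blast
qed auto

section \<open>Integrability of cylinder functions and contraction in mean\<close>

context stat_experiment
begin

lemma integrable_bounded_P:
  fixes f :: "'a \<Rightarrow> real"
  assumes "f \<in> borel_measurable B" "\<And>x. x \<in> space B \<Longrightarrow> \<bar>f x\<bar> \<le> C"
  shows "integrable (P i) f"
proof -
  interpret prob_space "P i" by (rule prob_space_P)
  show ?thesis using assms by (intro integrable_const_bound[of _ C]) auto
qed

lemma cyl_measurable_P: "cyl N \<Phi> \<Longrightarrow> (\<lambda>x. \<Phi> (\<lambda>i. lik_ratio (P i) (P o') x)) \<in> borel_measurable B"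
  by (rule cyl_measurable) auto

lemma integrable_cyl: "cyl N \<Phi> \<Longrightarrow> integrable (P j) (\<lambda>x. \<Phi> (\<lambda>i. lik_ratio (P i) (P o') x))"
  using cyl_bounded[of N \<Phi>] integrable_bounded_P[OF cyl_measurable_P] by blast

text \<open>Monotonicity squeezes the conditional expectation of the difference between plus and
  minus that of its absolute value, and integrating removes the conditioning. An approximation in
  mean thus survives conditioning without loss.\<close>

lemma cond_exp_L1_dist:
  assumes F: "subalgebra B F" and f: "integrable (P i) f" and g: "integrable (P i) g"
  shows "(\<integral>x. \<bar>real_cond_exp (P i) F f x - real_cond_exp (P i) F g x\<bar> \<partial>P i) \<le> (\<integral>x. \<bar>f x - g x\<bar> \<partial>P i)"
proof -
  interpret finite_measure_subalgebra "P i" F by (rule finite_measure_subalgebra_P[OF F])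
  let ?E = "real_cond_exp (P i) F"
  have d: "integrable (P i) (\<lambda>x. f x - g x)" using f g by auto
  have a: "integrable (P i) (\<lambda>x. \<bar>f x - g x\<bar>)" using d by (rule integrable_abs)
  have n: "integrable (P i) (\<lambda>x. - \<bar>f x - g x\<bar>)" using a by simp
  have 1: "AE x in P i. ?E (\<lambda>x. f x - g x) x = ?E f x - ?E g x"
    by (rule real_cond_exp_diff[OF f g])
  have 2: "AE x in P i. ?E (\<lambda>x. f x - g x) x \<le> ?E (\<lambda>x. \<bar>f x - g x\<bar>) x"
    by (rule real_cond_exp_mono[OF _ d a]) auto
  have 3: "AE x in P i. ?E (\<lambda>x. - \<bar>f x - g x\<bar>) x \<le> ?E (\<lambda>x. f x - g x) x"
    by (rule real_cond_exp_mono[OF _ n d]) auto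
  have 4: "AE x in P i. ?E (\<lambda>x. (-1) * \<bar>f x - g x\<bar>) x = (-1) * ?E (\<lambda>x. \<bar>f x - g x\<bar>) x"
    by (rule real_cond_exp_cmult[OF a])
  have "(\<integral>x. \<bar>?E f x - ?E g x\<bar> \<partial>P i) \<le> (\<integral>x. ?E (\<lambda>x. \<bar>f x - g x\<bar>) x \<partial>P i)"
  proof (rule integral_mono_AE)
    show "integrable (P i) (\<lambda>x. \<bar>?E f x - ?E g x\<bar>)"
      using real_cond_exp_int(1)[OF f] real_cond_exp_int(1)[OF g] by auto
    show "AE x in P i. \<bar>?E f x - ?E g x\<bar> \<le> ?E (\<lambda>x. \<bar>f x - g x\<bar>) x"
      using 1 2 3 4 by eventually_elim simp
  qed (rule real_cond_exp_int(1)[OF a])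
  also have "\<dots> = (\<integral>x. \<bar>f x - g x\<bar> \<partial>P i)" by (rule real_cond_exp_int(2)[OF a])
  finally show ?thesis .
qed

end

text \<open>One locale serves the limit and every member of the sequence. \<open>\<nu>\<close>
  embeds the nuisance parameters, and \<open>origin\<close> places the reference measure among the
  nuisance members, so that Basu's theorem applies under it.\<close>

locale nuisance_experiment = stat_experiment B P for B and P :: "'i \<Rightarrow> 'a measure" +
  fixes \<nu> :: "'j \<Rightarrow> 'i" and o' :: 'i and S D :: "'a measure"
  assumes origin: "o' \<in> range \<nu>"
    and suff: "sufficient B (\<lambda>j. P (\<nu> j)) S"
    and complete: "boundedly_complete B (\<lambda>j. P (\<nu> j)) S"
    and anc: "ancillary B (\<lambda>j. P (\<nu> j)) D"
begin

text \<open>The unrestricted counterpart of \<open>lik_vector\<close>: no finite index set has to be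
  carried along.\<close>

definition R :: "'a \<Rightarrow> 'i \<Rightarrow> real" where "R x = (\<lambda>i. lik_ratio (P i) (P o') x)"

sublocale sub: stat_experiment B "\<lambda>j. P (\<nu> j)" by (rule experiment_subfamily)

lemma subS: "subalgebra B S" and subD: "subalgebra B D"
  using suff anc by (auto simp: sufficient_def ancillary_def)

sublocale cD: finite_measure_subalgebra "P o'" D
  by (rule finite_measure_subalgebra_P[OF subD])

lemma cyl_R_measurable: "cyl N \<Phi> \<Longrightarrow> (\<lambda>x. \<Phi> (R x)) \<in> borel_measurable B"
  unfolding R_def by (rule cyl_measurable_P)

lemma integrable_cyl_R: "cyl N \<Phi> \<Longrightarrow> integrable (P i) (\<lambda>x. \<Phi> (R x))"
  unfolding R_def by (rule integrable_cyl)

text \<open>Basu's theorem wants functions measurable for \<open>S\<close>, which the nuisance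
  ratios are only up to null sets.\<close>

lemma cyl_S_version:
  "cyl (range \<nu>) \<Phi> \<Longrightarrow> \<exists>r\<in>borel_measurable S. AE x in P o'. \<Phi> (R x) = r x"
proof (induction rule: cyl.induct)
  case (cyl_coord i h)
  obtain j j0 where ij: "i = \<nu> j" "o' = \<nu> j0" using cyl_coord origin by auto
  from sub.sufficient_lik_ratio[OF suff, of j j0]
  have "\<exists>r\<in>borel_measurable S. AE x in P o'. R x i = r x" unfolding R_def unfolding ij .
  then obtain r where r: "r \<in> borel_measurable S" "AE x in P o'. R x i = r x" ..
  have "h \<in> borel_measurable borel" using cyl_coord(2) by (rule borel_measurable_continuous_onI)
  hence "(\<lambda>x. h (r x)) \<in> borel_measurable S" by (rule measurable_compose[OF r(1)])
  moreover have "AE x in P o'. h (R x i) = h (r x)" using r(2) by eventually_elim simp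
  ultimately show ?case by (intro bexI[of _ "\<lambda>x. h (r x)"])
next
  case (cyl_const c)
  show ?case by (rule bexI[of _ "\<lambda>_. c"]) auto
next
  case (cyl_add \<Phi> \<Psi>)
  from cyl_add.IH(1) obtain r where r: "r \<in> borel_measurable S" "AE x in P o'. \<Phi> (R x) = r x" ..
  from cyl_add.IH(2) obtain r' where r': "r' \<in> borel_measurable S" "AE x in P o'. \<Psi> (R x) = r' x" ..
  have "AE x in P o'. \<Phi> (R x) + \<Psi> (R x) = r x + r' x" using r(2) r'(2) by eventually_elim simp
  with r r' show ?case by (intro bexI[of _ "\<lambda>x. r x + r' x"]) auto
next
  case (cyl_mult \<Phi> \<Psi>)
  from cyl_mult.IH(1) obtain r where r: "r \<in> borel_measurable S" "AE x in P o'. \<Phi> (R x) = r x" ..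
  from cyl_mult.IH(2) obtain r' where r': "r' \<in> borel_measurable S" "AE x in P o'. \<Psi> (R x) = r' x" ..
  have "AE x in P o'. \<Phi> (R x) * \<Psi> (R x) = r x * r' x" using r(2) r'(2) by eventually_elim simp
  with r r' show ?case by (intro bexI[of _ "\<lambda>x. r x * r' x"]) auto
qed

text \<open>Basu's theorem makes \<open>\<Phi> (R x)\<close> uncorrelated with every event of
  \<open>D\<close>; its integral over such an event is therefore that of its mean.\<close>

lemma cond_exp_cyl:
  assumes \<Phi>: "cyl (range \<nu>) \<Phi>"
  shows "AE x in P o'. real_cond_exp (P o') D (\<lambda>x. \<Phi> (R x)) x = (\<integral>y. \<Phi> (R y) \<partial>P o')"
proof (rule cD.real_cond_exp_charact[OF _ integrable_cyl_R[OF \<Phi>]])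
  fix A assume A: "A \<in> sets D"
  have AB [measurable]: "A \<in> sets B" using subD A by (auto simp: subalgebra_def)
  interpret prob_space "P o'" by (rule prob_space_P)
  note [measurable] = cyl_R_measurable[OF \<Phi>]
  obtain j0 where j0: "o' = \<nu> j0" using origin by auto
  obtain r where rS: "r \<in> borel_measurable S" and r: "AE x in P o'. \<Phi> (R x) = r x"
    using cyl_S_version[OF \<Phi>] ..
  have [measurable]: "r \<in> borel_measurable B" using subS rS by (rule measurable_from_subalg)
  have int: "integrable (P o') r"
    by (subst integrable_cong_AE[OF _ _ AE_symmetric[OF r]]) (auto intro: integrable_cyl_R[OF \<Phi>])
  have "(\<integral>x\<in>A. \<Phi> (R x) \<partial>P o') = (\<integral>x. r x * indicator A x \<partial>P o')"
    unfolding set_lebesgue_integral_def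
    by (rule integral_cong_AE) (use r in \<open>auto simp: mult.commute\<close>)
  also have "\<dots> = (\<integral>x. r x \<partial>P o') * measure (P o') A"
    unfolding j0 by (rule sub.basu[OF suff complete anc A rS int[unfolded j0]])
  also have "(\<integral>x. r x \<partial>P o') = (\<integral>y. \<Phi> (R y) \<partial>P o')"
    by (rule integral_cong_AE) (use r in auto)
  also have "\<dots> * measure (P o') A = (\<integral>x\<in>A. (\<integral>y. \<Phi> (R y) \<partial>P o') \<partial>P o')"
    using AB by (simp add: set_lebesgue_integral_def sets.Int_space_eq2)
  finally show "(\<integral>x\<in>A. \<Phi> (R x) \<partial>P o') = (\<integral>x\<in>A. (\<integral>y. \<Phi> (R y) \<partial>P o') \<partial>P o')" .
qed auto

text \<open>The \<open>D\<close>-measurable factor is pulled out and the other one averages to a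
  constant. General bounded \<open>a\<close> are allowed because along the sequence the second
  factors are values of continuous functions and need not be indicators.\<close>

lemma cond_exp_tensor_sum:
  assumes "\<forall>p\<in>set xs. cyl (range \<nu>) (fst p)"
    and "\<And>\<Phi> A. (\<Phi>, A) \<in> set xs \<Longrightarrow> (\<lambda>x. a x A) \<in> borel_measurable D"
    and "\<And>\<Phi> A. (\<Phi>, A) \<in> set xs \<Longrightarrow> \<exists>C. \<forall>x\<in>space B. \<bar>a x A\<bar> \<le> C"
  shows "integrable (P o') (\<lambda>x. tensor_sum (\<lambda>\<Phi>. \<Phi> (R x)) (a x) xs)" (is "?I xs")
    and "AE x in P o'. real_cond_exp (P o') D (\<lambda>x. tensor_sum (\<lambda>\<Phi>. \<Phi> (R x)) (a x) xs) x
       = tensor_sum (\<lambda>\<Phi>. \<integral>y. \<Phi> (R y) \<partial>P o') (a x) xs" (is "?A xs")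
proof -
  \<comment> \<open>Both claims go through one induction because additivity of the conditional
    expectation needs the tail to be integrable.\<close>
  have "?I xs \<and> ?A xs" using assms
  proof (induction xs)
    case Nil
    show ?case using cD.real_cond_exp_F_meas[of "\<lambda>_. 0"] by simp
  next
    case (Cons y xs)
    obtain \<Phi> A where y: "y = (\<Phi>, A)" by force
    have \<Phi>: "cyl (range \<nu>) \<Phi>" and a: "(\<lambda>x. a x A) \<in> borel_measurable D"
      using Cons.prems by (auto simp: y)
    note [measurable] = cyl_R_measurable[OF \<Phi>] measurable_from_subalg[OF subD a]
    have "?I xs \<and> ?A xs"
    proof (rule Cons.IH)
      show "\<forall>p\<in>set xs. cyl (range \<nu>) (fst p)" using Cons.prems(1) by simp
      fix \<Phi> A assume "(\<Phi>, A) \<in> set xs"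
      hence mem: "(\<Phi>, A) \<in> set (y # xs)" by simp
      show "(\<lambda>x. a x A) \<in> borel_measurable D" by (rule Cons.prems(2)[OF mem])
      show "\<exists>C. \<forall>x\<in>space B. \<bar>a x A\<bar> \<le> C" by (rule Cons.prems(3)[OF mem])
    qed
    hence IH: "?I xs" "?A xs" by auto
    obtain C C' where C: "\<And>x. x \<in> space B \<Longrightarrow> \<bar>a x A\<bar> \<le> C" "\<And>u. \<bar>\<Phi> u\<bar> \<le> C'"
      using Cons.prems(3)[of \<Phi> A] cyl_bounded[OF \<Phi>] by (auto simp: y)
    have int: "integrable (P o') (\<lambda>x. a x A * \<Phi> (R x))"
    proof (rule integrable_bounded_P)
      show "\<bar>a x A * \<Phi> (R x)\<bar> \<le> C * C'" if "x \<in> space B" for x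
        unfolding abs_mult using C(1)[OF that] C(2)[of "R x"] by (intro mult_mono) auto
    qed measurable
    have 1: "AE x in P o'. real_cond_exp (P o') D (\<lambda>x. a x A * \<Phi> (R x)) x
      = a x A * real_cond_exp (P o') D (\<lambda>x. \<Phi> (R x)) x"
      by (rule cD.real_cond_exp_mult[OF a _ int]) measurable
    have 2: "AE x in P o'. real_cond_exp (P o') D
        (\<lambda>x. a x A * \<Phi> (R x) + tensor_sum (\<lambda>\<Phi>. \<Phi> (R x)) (a x) xs) x
      = real_cond_exp (P o') D (\<lambda>x. a x A * \<Phi> (R x)) x
        + real_cond_exp (P o') D (\<lambda>x. tensor_sum (\<lambda>\<Phi>. \<Phi> (R x)) (a x) xs) x"
      by (rule cD.real_cond_exp_add[OF int IH(1)])
    have "?A (y # xs)"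
      using 1 2 IH(2) cond_exp_cyl[OF \<Phi>] by eventually_elim (simp add: y mult.commute)
    moreover have "?I (y # xs)" using int IH(1) by (simp add: y mult.commute)
    ultimately show ?case by (rule conjI[rotated])
  qed
  thus "?I xs" "?A xs" by auto
qed

end

subsection \<open>Approximation in mean by an algebra of bounded functions\<close>

text \<open>A monotone class argument for an abstract algebra \<open>V\<close>. Products in
  \<open>V\<close> yield intersections of approximable events, and boundedness keeps multiplication
  by a member of \<open>V\<close> continuous in mean.\<close>

locale mean_approx = prob_space M for M :: "'a measure" +
  fixes V :: "('a \<Rightarrow> real) set"
  assumes V_meas: "g \<in> V \<Longrightarrow> g \<in> borel_measurable M"
    and V_bdd: "g \<in> V \<Longrightarrow> \<exists>C. \<forall>x\<in>space M. \<bar>g x\<bar> \<le> C"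
    and V_const: "(\<lambda>_. c) \<in> V"
    and V_add: "g \<in> V \<Longrightarrow> g' \<in> V \<Longrightarrow> (\<lambda>x. g x + g' x) \<in> V"
    and V_mult: "g \<in> V \<Longrightarrow> g' \<in> V \<Longrightarrow> (\<lambda>x. g x * g' x) \<in> V"
begin

definition approx :: "('a \<Rightarrow> real) \<Rightarrow> bool" where
  "approx f \<longleftrightarrow> integrable M f \<and> (\<forall>\<epsilon>>0. \<exists>g\<in>V. (\<integral>x. \<bar>f x - g x\<bar> \<partial>M) < \<epsilon>)"

lemma approx_integrable: "approx f \<Longrightarrow> integrable M f"
  by (simp add: approx_def)

lemma V_int:
  assumes "g \<in> V"
  shows "integrable M g"
proof -
  obtain C where "\<forall>x\<in>space M. \<bar>g x\<bar> \<le> C" using V_bdd[OF assms] ..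
  thus ?thesis by (intro integrable_const_bound[of _ C] V_meas assms) auto
qed

lemma approxD:
  assumes "approx f" "\<epsilon> > 0"
  obtains g where "g \<in> V" "(\<integral>x. \<bar>f x - g x\<bar> \<partial>M) < \<epsilon>"
  using assms unfolding approx_def by blast

lemma approx_V: "g \<in> V \<Longrightarrow> approx g"
  unfolding approx_def using V_int by (auto intro!: bexI[of _ g])

lemma integral_triangle:
  fixes f g h :: "'a \<Rightarrow> real"
  assumes "integrable M f" "integrable M g" "integrable M h"
  shows "(\<integral>x. \<bar>f x - h x\<bar> \<partial>M) \<le> (\<integral>x. \<bar>f x - g x\<bar> \<partial>M) + (\<integral>x. \<bar>g x - h x\<bar> \<partial>M)"
proof -
  have "(\<integral>x. \<bar>f x - h x\<bar> \<partial>M) \<le> (\<integral>x. \<bar>f x - g x\<bar> + \<bar>g x - h x\<bar> \<partial>M)"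
    by (rule Bochner_Integration.integral_mono) (use assms in auto)
  thus ?thesis using assms by simp
qed

lemma approx_lim:
  assumes f: "integrable M f"
    and ex: "\<And>\<epsilon>. \<epsilon> > 0 \<Longrightarrow> \<exists>f'. approx f' \<and> (\<integral>x. \<bar>f x - f' x\<bar> \<partial>M) < \<epsilon>"
  shows "approx f"
  unfolding approx_def
proof (intro conjI allI impI f)
  fix \<epsilon> :: real assume "\<epsilon> > 0"
  then obtain f' where f': "approx f'" "(\<integral>x. \<bar>f x - f' x\<bar> \<partial>M) < \<epsilon> / 2"
    using ex[of "\<epsilon> / 2"] by auto
  then obtain g where g: "g \<in> V" "(\<integral>x. \<bar>f' x - g x\<bar> \<partial>M) < \<epsilon> / 2"
    using approxD[of f' "\<epsilon> / 2"] \<open>\<epsilon> > 0\<close> by auto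
  have "(\<integral>x. \<bar>f x - g x\<bar> \<partial>M) < \<epsilon>"
    using integral_triangle[OF f approx_integrable[OF f'(1)] V_int[OF g(1)]] f' g by simp
  thus "\<exists>g\<in>V. (\<integral>x. \<bar>f x - g x\<bar> \<partial>M) < \<epsilon>" using g by blast
qed

lemma approx_AE_cong:
  assumes "approx f'" "integrable M f" "AE x in M. f x = f' x"
  shows "approx f"
proof (rule approx_lim[OF assms(2)])
  fix \<epsilon> :: real assume "\<epsilon> > 0"
  have "(\<integral>x. \<bar>f x - f' x\<bar> \<partial>M) = 0"
    by (rule integral_eq_zero_AE) (use assms(3) in eventually_elim, simp)
  with \<open>\<epsilon> > 0\<close> show "\<exists>f'. approx f' \<and> (\<integral>x. \<bar>f x - f' x\<bar> \<partial>M) < \<epsilon>"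
    using assms(1) by (intro exI[of _ f']) simp
qed

lemma approx_dominated:
  assumes s: "\<And>n. approx (s n)" and f: "integrable M f" and w: "integrable M w"
    and lim: "\<And>x. x \<in> space M \<Longrightarrow> (\<lambda>n. s n x) \<longlonglongrightarrow> f x"
    and bd: "\<And>n x. x \<in> space M \<Longrightarrow> \<bar>s n x\<bar> \<le> w x"
  shows "approx f"
proof (rule approx_lim[OF f])
  fix \<epsilon> :: real assume "\<epsilon> > 0"
  have "(\<lambda>n. \<integral>x. \<bar>f x - s n x\<bar> \<partial>M) \<longlonglongrightarrow> (\<integral>x. 0 \<partial>M)"
  proof (rule integral_dominated_convergence[where w = "\<lambda>x. \<bar>f x\<bar> + w x"])
    show "(\<lambda>x. \<bar>f x - s n x\<bar>) \<in> borel_measurable M" for n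
      using approx_integrable[OF s] f by auto
    show "AE x in M. (\<lambda>n. \<bar>f x - s n x\<bar>) \<longlonglongrightarrow> 0"
    proof (rule AE_I2)
      fix x assume "x \<in> space M"
      from tendsto_rabs[OF tendsto_diff[OF tendsto_const[of "f x"] lim[OF this]]]
      show "(\<lambda>n. \<bar>f x - s n x\<bar>) \<longlonglongrightarrow> 0" by simp
    qed
    show "AE x in M. norm \<bar>f x - s n x\<bar> \<le> \<bar>f x\<bar> + w x" for n
      using bd[of _ n] by (intro AE_I2) (auto intro: order_trans[OF abs_triangle_ineq4])
    show "integrable M (\<lambda>x. \<bar>f x\<bar> + w x)" using f w by auto
  qed auto
  hence "\<forall>\<^sub>F n in sequentially. (\<integral>x. \<bar>f x - s n x\<bar> \<partial>M) < \<epsilon>"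
    using \<open>\<epsilon> > 0\<close> by (intro order_tendstoD(2)) auto
  then obtain n where "(\<integral>x. \<bar>f x - s n x\<bar> \<partial>M) < \<epsilon>"
    by (auto simp: eventually_sequentially)
  thus "\<exists>f'. approx f' \<and> (\<integral>x. \<bar>f x - f' x\<bar> \<partial>M) < \<epsilon>" using s by blast
qed

lemma approx_add:
  assumes "approx f" "approx f'"
  shows "approx (\<lambda>x. f x + f' x)"
  unfolding approx_def
proof (intro conjI allI impI)
  note int = assms[THEN approx_integrable]
  show "integrable M (\<lambda>x. f x + f' x)" using int by auto
  fix \<epsilon> :: real assume "\<epsilon> > 0"
  hence "\<epsilon> / 2 > 0" by simp
  obtain g where g: "g \<in> V" "(\<integral>x. \<bar>f x - g x\<bar> \<partial>M) < \<epsilon> / 2"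
    using approxD[OF assms(1) \<open>\<epsilon> / 2 > 0\<close>] .
  obtain g' where g': "g' \<in> V" "(\<integral>x. \<bar>f' x - g' x\<bar> \<partial>M) < \<epsilon> / 2"
    using approxD[OF assms(2) \<open>\<epsilon> / 2 > 0\<close>] .
  note int' = V_int[OF g(1)] V_int[OF g'(1)]
  have "(\<integral>x. \<bar>f x + f' x - (g x + g' x)\<bar> \<partial>M) \<le> (\<integral>x. \<bar>f x - g x\<bar> + \<bar>f' x - g' x\<bar> \<partial>M)"
    by (rule Bochner_Integration.integral_mono) (use int int' in auto)
  also have "\<dots> < \<epsilon>" using int int' g g' by simp
  finally show "\<exists>g\<in>V. (\<integral>x. \<bar>f x + f' x - g x\<bar> \<partial>M) < \<epsilon>"
    by (intro bexI[OF _ V_add[OF g(1) g'(1)]])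
qed

lemma approx_mult_V:
  assumes f: "approx f" and g: "g \<in> V"
  shows "approx (\<lambda>x. f x * g x)"
  unfolding approx_def
proof (intro conjI allI impI)
  obtain C where C: "\<And>x. x \<in> space M \<Longrightarrow> \<bar>g x\<bar> \<le> C" using V_bdd[OF g] by blast
  obtain x0 where "x0 \<in> space M" using not_empty by auto
  with C[of x0] have C0: "C \<ge> 0" by linarith
  have int: "integrable M (\<lambda>x. h x * g x)" if "integrable M h" for h
  proof (rule Bochner_Integration.integrable_bound)
    show "integrable M (\<lambda>x. C * h x)" using that by simp
    show "AE x in M. norm (h x * g x) \<le> norm (C * h x)"
      using C C0 by (intro AE_I2) (auto simp: abs_mult mult.commute intro!: mult_right_mono)
  qed (use that V_meas[OF g] in auto)
  show "integrable M (\<lambda>x. f x * g x)" by (rule int[OF approx_integrable[OF f]])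
  fix \<epsilon> :: real assume "\<epsilon> > 0"
  \<comment> \<open>The bound \<open>C\<close> may be zero; adding one keeps the divisor
    positive.\<close>
  hence "\<epsilon> / (C + 1) > 0" using C0 by simp
  then obtain f' where f': "f' \<in> V" "(\<integral>x. \<bar>f x - f' x\<bar> \<partial>M) < \<epsilon> / (C + 1)"
    using approxD[OF f] by blast
  have d: "integrable M (\<lambda>x. f x - f' x)" using approx_integrable[OF f] V_int[OF f'(1)] by simp
  have "(\<integral>x. \<bar>f x * g x - f' x * g x\<bar> \<partial>M) \<le> (\<integral>x. (C + 1) * \<bar>f x - f' x\<bar> \<partial>M)"
  proof (rule Bochner_Integration.integral_mono)
    show "integrable M (\<lambda>x. \<bar>f x * g x - f' x * g x\<bar>)"
      using int[OF d] by (simp add: left_diff_distrib)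
    show "\<bar>f x * g x - f' x * g x\<bar> \<le> (C + 1) * \<bar>f x - f' x\<bar>" if "x \<in> space M" for x
      using C[OF that] by (auto simp: left_diff_distrib[symmetric] abs_mult mult.commute intro!: mult_right_mono)
  qed (use d in auto)
  also have "\<dots> = (C + 1) * (\<integral>x. \<bar>f x - f' x\<bar> \<partial>M)" by (rule integral_mult_right_zero)
  also have "\<dots> < \<epsilon>" using f'(2) C0 by (simp add: field_simps)
  finally show "\<exists>h\<in>V. (\<integral>x. \<bar>f x * g x - h x\<bar> \<partial>M) < \<epsilon>"
    by (intro bexI[OF _ V_mult[OF f'(1) g]])
qed

lemma approx_cmult: "approx f \<Longrightarrow> approx (\<lambda>x. c * f x)"
  using approx_mult_V[OF _ V_const, of f c] by (simp add: mult.commute)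

text \<open>The bound of an approximant is not controlled by its accuracy, so the factors are
  replaced one after the other: first \<open>f'\<close> by some \<open>g\<close>, at no cost since
  \<open>f\<close> is bounded by one, and then \<open>f\<close>, with \<open>g\<close> and its bound
  already fixed.\<close>

lemma approx_mult:
  assumes f: "approx f" and f1: "\<And>x. \<bar>f x\<bar> \<le> 1" and f': "approx f'"
  shows "approx (\<lambda>x. f x * f' x)"
proof (rule approx_lim)
  have int: "integrable M (\<lambda>x. f x * h x)" if "integrable M h" for h
  proof (rule Bochner_Integration.integrable_bound[OF that])
    show "AE x in M. norm (f x * h x) \<le> norm (h x)"
      using f1 by (intro AE_I2) (auto simp: abs_mult intro!: mult_left_le_one_le)
  qed (use that approx_integrable[OF f] in auto)
  show "integrable M (\<lambda>x. f x * f' x)" by (rule int[OF approx_integrable[OF f']])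
  fix \<epsilon> :: real assume "\<epsilon> > 0"
  then obtain g where g: "g \<in> V" "(\<integral>x. \<bar>f' x - g x\<bar> \<partial>M) < \<epsilon>" using approxD[OF f'] by blast
  have d: "integrable M (\<lambda>x. f' x - g x)" using approx_integrable[OF f'] V_int[OF g(1)] by simp
  have "(\<integral>x. \<bar>f x * f' x - f x * g x\<bar> \<partial>M) \<le> (\<integral>x. \<bar>f' x - g x\<bar> \<partial>M)"
  proof (rule Bochner_Integration.integral_mono)
    show "integrable M (\<lambda>x. \<bar>f x * f' x - f x * g x\<bar>)"
      using int[OF d] by (simp add: right_diff_distrib)
    show "\<bar>f x * f' x - f x * g x\<bar> \<le> \<bar>f' x - g x\<bar>" for x
      using f1[of x] by (auto simp: right_diff_distrib[symmetric] abs_mult intro!: mult_left_le_one_le)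
  qed (use d in auto)
  also note g(2)
  finally show "\<exists>h. approx h \<and> (\<integral>x. \<bar>f x * f' x - h x\<bar> \<partial>M) < \<epsilon>"
    using approx_mult_V[OF f g(1)] by blast
qed

definition approx_sets :: "'a set set" where
  "approx_sets = {A \<in> sets M. approx (indicator A)}"

lemma approx_sets_Int:
  assumes "A \<in> approx_sets" "A' \<in> approx_sets"
  shows "A \<inter> A' \<in> approx_sets"
  using assms approx_mult[of "indicator A" "indicator A'"]
  by (auto simp: approx_sets_def indicator_inter_arith[abs_def] indicator_def)

lemma approx_sets_compl:
  assumes "A \<in> approx_sets"
  shows "space M - A \<in> approx_sets"
proof -
  have "approx (\<lambda>x. 1 + (-1) * indicator A x)"
    by (rule approx_add[OF approx_V[OF V_const] approx_cmult]) (use assms in \<open>simp add: approx_sets_def\<close>)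
  moreover have "integrable M (indicator (space M - A) :: _ \<Rightarrow> real)"
    using assms by (auto simp: approx_sets_def less_top[symmetric])
  moreover have "AE x in M. indicator (space M - A) x = 1 + (-1) * (indicator A x :: real)"
    by (rule AE_I2) (auto simp: indicator_def)
  ultimately have "approx (indicator (space M - A))" by (rule approx_AE_cong)
  thus ?thesis using assms by (auto simp: approx_sets_def)
qed

lemma approx_sets_Un:
  assumes "A \<in> approx_sets" "A' \<in> approx_sets"
  shows "A \<union> A' \<in> approx_sets"
proof -
  have "A \<union> A' = space M - ((space M - A) \<inter> (space M - A'))"
    using assms by (auto simp: approx_sets_def dest: sets.sets_into_space)
  also have "\<dots> \<in> approx_sets" by (intro approx_sets_compl approx_sets_Int assms)
  finally show ?thesis .
qed

text \<open>Complements and intersections give finite unions, and dominated convergence passes from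
  these to countable ones.\<close>

lemma sigma_algebra_approx_sets: "sigma_algebra (space M) approx_sets"
  unfolding sigma_algebra_iff2
proof (intro conjI ballI allI impI)
  show "approx_sets \<subseteq> Pow (space M)" by (auto simp: approx_sets_def dest: sets.sets_into_space)
  show empty: "{} \<in> approx_sets" using approx_V[OF V_const[of 0]] by (simp add: approx_sets_def indicator_def[abs_def])
  show "space M - A \<in> approx_sets" if "A \<in> approx_sets" for A
    using that by (rule approx_sets_compl)
  fix A :: "nat \<Rightarrow> 'a set" assume A: "range A \<subseteq> approx_sets"
  have fin: "(\<Union>i<n. A i) \<in> approx_sets" for n
    using A by (induction n) (auto simp: empty lessThan_Suc intro!: approx_sets_Un)
  have U: "(\<Union>i. A i) \<in> sets M" using A by (auto simp: approx_sets_def)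
  have "approx (indicator (\<Union>i. A i))"
  proof (rule approx_dominated[where w = "\<lambda>_. 1" and s = "\<lambda>n. indicator (\<Union>i<n. A i)"])
    show "approx (indicator (\<Union>i<n. A i))" for n using fin by (simp add: approx_sets_def)
    show "(\<lambda>n. indicator (\<Union>i<n. A i) x) \<longlonglongrightarrow> (indicator (\<Union>i. A i) x :: real)" for x
      by (rule LIMSEQ_indicator_UN)
  qed (use U in \<open>auto simp: indicator_def less_top[symmetric]\<close>)
  thus "(\<Union>i. A i) \<in> approx_sets" using U by (simp add: approx_sets_def)
qed

lemma approx_all:
  assumes all: "sets M \<subseteq> approx_sets" and f: "integrable M f"
  shows "approx f"
  using f
proof (induction rule: integrable_induct)
  case (base A c)
  have "approx (\<lambda>x. c * indicator A x)"
    by (rule approx_cmult) (use all base(1) in \<open>auto simp: approx_sets_def\<close>)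
  thus ?case by (simp add: mult.commute)
next
  case (add f g)
  show ?case by (rule approx_add[OF add(3,4)])
next
  case (lim f s)
  show ?case
  \<comment> \<open>The factor 2 is the one that the induction rule for integrable functions
    provides.\<close>
  proof (rule approx_dominated[where s = s and w = "\<lambda>x. 2 * \<bar>f x\<bar>"])
    show "approx (s n)" for n by (rule lim(5))
    show "integrable M f" by (rule lim(4))
    thus "integrable M (\<lambda>x. 2 * \<bar>f x\<bar>)" by simp
    show "(\<lambda>n. s n x) \<longlonglongrightarrow> f x" if "x \<in> space M" for x using that by (rule lim(2))
    show "\<bar>s n x\<bar> \<le> 2 * \<bar>f x\<bar>" if "x \<in> space M" for n x using lim(3)[OF that, of n] by simp
  qed
qed

end

section \<open>The factorization criterion, converse half\<close>

context stat_experiment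
begin

text \<open>The conditional probability computed under \<open>P j\<close> serves every
  \<open>P i\<close>: the change of measure multiplies the integrand by a
  \<open>T\<close>-measurable density, which behaves like any other \<open>T\<close>-measurable
  factor.\<close>

lemma sufficientI_lik_ratio:
  assumes T: "subalgebra B T"
    and L: "\<And>i. lik_ratio (P i) (P j) \<in> borel_measurable T"
  shows "sufficient B P T"
  unfolding sufficient_def
proof (intro conjI ballI T)
  fix A assume A [measurable]: "A \<in> sets B"
  interpret j: finite_measure_subalgebra "P j" T by (rule finite_measure_subalgebra_P[OF T])
  let ?f = "real_cond_exp (P j) T (indicator A)"
  have fT [measurable]: "?f \<in> borel_measurable T" by (rule borel_measurable_cond_exp)
  have [measurable]: "?f \<in> borel_measurable B" by (rule measurable_from_subalg[OF T fT])
  have "AE x in P i. real_cond_exp (P i) T (indicator A) x = ?f x" for i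
  proof -
    interpret i: finite_measure_subalgebra "P i" T by (rule finite_measure_subalgebra_P[OF T])
    let ?L = "lik_ratio (P i) (P j)"
    note [measurable] = L[of i]
    \<comment> \<open>Two instances are used: the constant one for integrability of
      \<open>?f\<close> under \<open>P i\<close>, and the indicator of an event of \<open>T\<close>
      for the characterization.\<close>
    have *: "integrable (P j) (\<lambda>x. g x * ?f x * ?L x)"
      "(\<integral>x. g x * ?f x * ?L x \<partial>P j) = (\<integral>x. g x * indicator A x * ?L x \<partial>P j)"
      if gT [measurable]: "g \<in> borel_measurable T" and g: "\<And>x. \<bar>g x\<bar> \<le> 1" for g
    proof -
      have [measurable]: "g \<in> borel_measurable B" by (rule measurable_from_subalg[OF T gT])
      have "integrable (P j) (\<lambda>x. g x * ?L x * indicator A x)"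
      proof (rule Bochner_Integration.integrable_bound[OF integrable_lik[of j i]])
        show "AE x in P j. norm (g x * ?L x * indicator A x) \<le> norm (?L x)"
          using g by (intro AE_I2) (auto simp: abs_mult indicator_def intro!: mult_left_le_one_le)
      qed simp
      from j.real_cond_exp_intg[OF this]
      show "integrable (P j) (\<lambda>x. g x * ?f x * ?L x)"
        "(\<integral>x. g x * ?f x * ?L x \<partial>P j) = (\<integral>x. g x * indicator A x * ?L x \<partial>P j)"
        by (simp_all add: mult_ac)
    qed
    show ?thesis
    proof (rule i.real_cond_exp_charact)
      show "integrable (P i) (indicator A :: _ \<Rightarrow> real)" by (rule integrable_bounded_P[of _ 1]) auto
      show "integrable (P i) ?f"
        using *(1)[of "\<lambda>_. 1"] by (subst integrable_lik_iff[where j = j]) auto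
      fix C assume C [measurable]: "C \<in> sets T"
      have [measurable]: "C \<in> sets B" using C T by (auto simp: subalgebra_def)
      have "(\<integral>x\<in>C. indicator A x \<partial>P i) = (\<integral>x. indicator C x * indicator A x * ?L x \<partial>P j)"
        unfolding set_lebesgue_integral_def
        by (subst integral_lik[where j = j]) auto
      also have "\<dots> = (\<integral>x. indicator C x * ?f x * ?L x \<partial>P j)"
        using *(2)[of "indicator C"] by (simp add: indicator_def)
      also have "\<dots> = (\<integral>x\<in>C. ?f x \<partial>P i)"
        unfolding set_lebesgue_integral_def
        by (subst integral_lik[where j = j]) auto
      finally show "(\<integral>x\<in>C. indicator A x \<partial>P i) = (\<integral>x\<in>C. ?f x \<partial>P i)" .
    qed (rule fT)
  qed
  thus "\<exists>f\<in>borel_measurable T. \<forall>i. AE x in P i. real_cond_exp (P i) T (indicator A) x = f x"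
    using fT by blast
qed

end

text \<open>This depends on the second factors being indicators, whose products are indicators of
  intersections and so stay with events of \<open>D\<close>.\<close>

lemma tensor_sum_mult:
  fixes u :: "'i \<Rightarrow> real" and x :: 'a
  shows "tensor_sum (\<lambda>\<Phi>. \<Phi> u) (\<lambda>A. indicator A x) xs * tensor_sum (\<lambda>\<Phi>. \<Phi> u) (\<lambda>A. indicator A x) ys
    = tensor_sum (\<lambda>\<Phi>. \<Phi> u) (\<lambda>A. indicator A x)
        (concat (map (\<lambda>(\<Phi>, A). map (\<lambda>(\<Psi>, A'). (\<lambda>u. \<Phi> u * \<Psi> u, A \<inter> A')) ys) xs))"
    (is "?t xs * ?t ys = _")
proof (induction xs)
  case (Cons y xs)
  obtain \<Phi> A where y: "y = (\<Phi>, A)" by force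
  have "?t (map (\<lambda>(\<Psi>, A'). (\<lambda>u. \<Phi> u * \<Psi> u, A \<inter> A')) ys) = \<Phi> u * indicator A x * ?t ys"
    by (induction ys) (auto simp: indicator_inter_arith algebra_simps)
  thus ?case by (simp add: y Cons.IH[symmetric] distrib_right)
qed simp

section \<open>Density in mean of sums of products\<close>

context nuisance_experiment
begin

definition admissible :: "((('i \<Rightarrow> real) \<Rightarrow> real) \<times> 'a set) list \<Rightarrow> bool" where
  "admissible xs \<longleftrightarrow> (\<forall>(\<Phi>, A)\<in>set xs. cyl (range \<nu>) \<Phi> \<and> A \<in> sets D)"

definition tensor_val :: "((('i \<Rightarrow> real) \<Rightarrow> real) \<times> 'a set) list \<Rightarrow> 'a \<Rightarrow> real" where
  "tensor_val xs x = tensor_sum (\<lambda>\<Phi>. \<Phi> (R x)) (\<lambda>A. indicator A x) xs"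

lemma admissible_mem: "admissible xs \<Longrightarrow> (\<Phi>, A) \<in> set xs \<Longrightarrow> cyl (range \<nu>) \<Phi>"
  "admissible xs \<Longrightarrow> (\<Phi>, A) \<in> set xs \<Longrightarrow> A \<in> sets D"
  by (auto simp: admissible_def)

lemma D_sub: "A \<in> sets D \<Longrightarrow> A \<in> sets B" "space D = space B"
  using subD by (auto simp: subalgebra_def)

lemma tensor_val_measurable:
  assumes "admissible xs"
  shows "tensor_val xs \<in> borel_measurable B"
  unfolding tensor_val_def[abs_def]
  using admissible_mem[OF assms] cyl_R_measurable D_sub
  by (intro measurable_tensor_sum borel_measurable_indicator) blast+

lemma tensor_val_bounded:
  assumes "admissible xs"
  shows "\<exists>C. \<forall>x\<in>space B. \<bar>tensor_val xs x\<bar> \<le> C"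
  unfolding tensor_val_def
proof (rule tensor_sum_bounded)
  fix \<Phi> A assume "(\<Phi>, A) \<in> set xs"
  then obtain C where "\<And>u. \<bar>\<Phi> u\<bar> \<le> C" using admissible_mem[OF assms] cyl_bounded by blast
  thus "(\<exists>C. \<forall>x\<in>space B. \<bar>\<Phi> (R x)\<bar> \<le> C) \<and> (\<exists>C. \<forall>x\<in>space B. \<bar>indicator A x :: real\<bar> \<le> C)"
    by (intro conjI exI[of _ C] exI[of _ 1]) (auto simp: indicator_def)
qed

text \<open>Agreement is required on \<open>space B\<close> only: constants are represented with the
  event \<open>space B\<close>, whose indicator is one only there.\<close>

lemma mean_approx_tensor:
  "mean_approx (P o') {g. \<exists>xs. admissible xs \<and> (\<forall>x\<in>space B. g x = tensor_val xs x)}" (is "mean_approx _ ?V")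
  unfolding mean_approx_def mean_approx_axioms_def
proof (intro conjI allI impI prob_space_P)
  fix g assume "g \<in> ?V"
  then obtain xs where xs: "admissible xs" "\<And>x. x \<in> space B \<Longrightarrow> g x = tensor_val xs x" by blast
  show "g \<in> borel_measurable (P o')"
    using tensor_val_measurable[OF xs(1)] by (subst measurable_cong[OF xs(2)]) auto
  show "\<exists>C. \<forall>x\<in>space (P o'). \<bar>g x\<bar> \<le> C"
    using tensor_val_bounded[OF xs(1)] xs(2) by simp
  fix g' assume "g' \<in> ?V"
  then obtain ys where ys: "admissible ys" "\<And>x. x \<in> space B \<Longrightarrow> g' x = tensor_val ys x" by blast
  have "admissible (xs @ ys)" using xs(1) ys(1) by (auto simp: admissible_def)
  moreover have "\<forall>x\<in>space B. g x + g' x = tensor_val (xs @ ys) x"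
    using xs(2) ys(2) by (simp add: tensor_val_def)
  ultimately show "(\<lambda>x. g x + g' x) \<in> ?V" by blast
  let ?zs = "concat (map (\<lambda>(\<Phi>, A). map (\<lambda>(\<Psi>, A'). (\<lambda>u. \<Phi> u * \<Psi> u, A \<inter> A')) ys) xs)"
  have "admissible ?zs"
    using xs(1) ys(1) by (fastforce simp: admissible_def intro: cyl_mult)
  moreover have "\<forall>x\<in>space B. g x * g' x = tensor_val ?zs x"
    using xs(2) ys(2) by (simp add: tensor_val_def tensor_sum_mult)
  ultimately show "(\<lambda>x. g x * g' x) \<in> ?V" by blast
next
  fix c :: real
  have "admissible [(\<lambda>_. c, space B)]"
    using sets.top[of D] D_sub(2) by (auto simp: admissible_def intro: cyl_const)
  moreover have "\<forall>x\<in>space B. c = tensor_val [(\<lambda>_. c, space B)] x"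
    by (simp add: tensor_val_def)
  ultimately show "(\<lambda>_. c) \<in> ?V" by blast
qed

text \<open>By minimality, \<open>S\<close> lies, up to null sets, in the \<open>\<sigma>\<close>-field generated by the nuisance
  likelihood ratios, so together with \<open>D\<close> these ratios carry the whole experiment.\<close>

lemma tensor_dense:
  assumes minimal: "minimal_sufficient B (\<lambda>j. P (\<nu> j)) S" and gen: "jointly_generate B S D"
    and f: "integrable (P o') f" and "\<epsilon> > 0"
  obtains xs where "admissible xs" "(\<integral>x. \<bar>f x - tensor_val xs x\<bar> \<partial>P o') < \<epsilon>"
proof -
  let ?V = "{g. \<exists>xs. admissible xs \<and> (\<forall>x\<in>space B. g x = tensor_val xs x)}"
  interpret V: mean_approx "P o'" ?V by (rule mean_approx_tensor)
  have sig: "sigma_sets (space B) G \<subseteq> V.approx_sets" if "G \<subseteq> V.approx_sets" for G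
    using sigma_algebra.sigma_sets_subset[OF V.sigma_algebra_approx_sets that] by simp
  let ?G = "{{x\<in>space B. R x i < c} | i c. i \<in> range \<nu>}"
  \<comment> \<open>\<open>T\<close> is generated by the nuisance ratios. Once it is known to be
    sufficient, minimality places \<open>S\<close> inside it up to null sets.\<close>
  define T where "T = sigma (space B) ?G"
  have Rmeas [measurable]: "(\<lambda>x. R x i) \<in> borel_measurable B" for i by (simp add: R_def)
  have GB: "?G \<subseteq> sets B" by auto
  hence GP: "?G \<subseteq> Pow (space B)" by auto
  have setsT: "sets T = sigma_sets (space B) ?G" and spT: "space T = space B"
    unfolding T_def using GP by (simp_all add: sets_measure_of space_measure_of)
  have subT: "subalgebra B T"
    unfolding subalgebra_def setsT spT using sets.sigma_sets_subset[OF GB] by simp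
  have LT: "lik_ratio (P (\<nu> j)) (P o') \<in> borel_measurable T" for j
  proof (rule borel_measurableI_less)
    fix y :: real
    have "{x\<in>space B. R x (\<nu> j) < y} \<in> sigma_sets (space B) ?G"
      by (rule sigma_sets.Basic) blast
    thus "{x\<in>space T. lik_ratio (P (\<nu> j)) (P o') x < y} \<in> sets T"
      by (simp add: setsT spT R_def)
  qed
  obtain j0 where j0: "o' = \<nu> j0" using origin by auto
  have "sufficient B (\<lambda>j. P (\<nu> j)) T"
    by (rule sub.sufficientI_lik_ratio[OF subT, of j0]) (use LT in \<open>simp add: j0\<close>)
  hence ST: "included_mod_null (\<lambda>j. P (\<nu> j)) S T"
    using minimal by (auto simp: minimal_sufficient_def)
  have "{x\<in>space B. R x i < c} \<in> V.approx_sets" if i: "i \<in> range \<nu>" for i c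
  proof -
    \<comment> \<open>Continuous ramps that increase to the indicator of the open half-line below
      \<open>c\<close>; at \<open>c\<close> itself they all vanish, in accordance with the strict
      inequality in the generators.\<close>
    define h :: "nat \<Rightarrow> real \<Rightarrow> real" where "h n y = min 1 (max 0 (real n * (c - y)))" for n y
    have h: "cyl (range \<nu>) (\<lambda>u. h n (u i))" for n
    proof (rule cyl_coord[OF i])
      show "continuous_on UNIV (h n)" unfolding h_def by (intro continuous_intros)
      show "bounded (range (h n))" by (auto simp: bounded_iff h_def intro!: exI[of _ 1])
    qed
    have lim: "(\<lambda>n. h n y) \<longlonglongrightarrow> (if y < c then 1 else 0)" for y
    proof (cases "y < c")
      case True
      obtain N where N: "1 / (c - y) \<le> real N" using real_arch_simple by blast
      have "h n y = 1" if "n \<ge> N" for n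
      proof -
        have "1 \<le> real N * (c - y)" using N True by (simp add: field_simps)
        also have "\<dots> \<le> real n * (c - y)" using that True by (intro mult_right_mono) auto
        finally show ?thesis by (simp add: h_def)
      qed
      hence "\<forall>\<^sub>F n in sequentially. h n y = 1" by (auto simp: eventually_sequentially)
      thus ?thesis using True by (simp add: tendsto_eventually)
    next
      case False
      have "h n y = 0" for n
      proof -
        have "real n * (c - y) \<le> 0" using False by (intro mult_nonneg_nonpos) auto
        thus ?thesis by (simp add: h_def)
      qed
      thus ?thesis using False by simp
    qed
    have "V.approx (indicator {x\<in>space B. R x i < c})"
    proof (rule V.approx_dominated[where s = "\<lambda>n x. h n (R x i)" and w = "\<lambda>_. 1"])
      fix n
      have "admissible [(\<lambda>u. h n (u i), space B)]"
        using sets.top[of D] D_sub(2) h by (auto simp: admissible_def)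
      moreover have "\<forall>x\<in>space B. h n (R x i) = tensor_val [(\<lambda>u. h n (u i), space B)] x"
        by (simp add: tensor_val_def)
      ultimately show "V.approx (\<lambda>x. h n (R x i))" by (intro V.approx_V) blast
    next
      show "(\<lambda>n. h n (R x i)) \<longlonglongrightarrow> indicator {x\<in>space B. R x i < c} x" if "x \<in> space (P o')" for x
        using lim[of "R x i"] that by (auto simp: indicator_def split: if_splits)
      show "integrable (P o') (indicator {x\<in>space B. R x i < c} :: _ \<Rightarrow> real)"
        by (rule integrable_bounded_P[of _ 1]) (auto simp: indicator_def)
    qed (auto simp: h_def)
    thus ?thesis by (auto simp: V.approx_sets_def)
  qed
  hence TV: "sets T \<subseteq> V.approx_sets" unfolding setsT by (intro sig) blast
  have SV: "sets S \<subseteq> V.approx_sets"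
  proof
    fix A assume "A \<in> sets S"
    hence A: "A \<in> sets B" using subS by (auto simp: subalgebra_def)
    obtain A' where A': "A' \<in> sets T" "measure (P o') (sym_diff A A') = 0"
      using ST \<open>A \<in> sets S\<close> unfolding included_mod_null_def j0 by blast
    have A'B: "A' \<in> sets B" using A'(1) subT by (auto simp: subalgebra_def)
    \<comment> \<open>Approximation in mean does not see null sets, so inclusion up to null sets is
      enough to pass from \<open>A'\<close> to \<open>A\<close>.\<close>
    have "sym_diff A A' \<in> null_sets (P o')"
      using A'(2) A A'B by (auto simp: null_sets_def cD.emeasure_eq_measure)
    hence "AE x in P o'. x \<notin> sym_diff A A'" by (rule AE_not_in)
    hence eq: "AE x in P o'. indicator A x = (indicator A' x :: real)"
      by eventually_elim (auto simp: indicator_def)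
    have int: "integrable (P o') (indicator A :: _ \<Rightarrow> real)"
      using A by (intro integrable_bounded_P[of _ 1]) auto
    have "V.approx (indicator A')" using TV A'(1) unfolding V.approx_sets_def by blast
    hence "V.approx (indicator A)" using int eq by (rule V.approx_AE_cong)
    thus "A \<in> V.approx_sets" using A by (simp add: V.approx_sets_def)
  qed
  have DV: "sets D \<subseteq> V.approx_sets"
  proof
    fix A assume A: "A \<in> sets D"
    have "admissible [(\<lambda>_. 1, A)]" using A by (auto simp: admissible_def intro: cyl_const)
    moreover have "\<forall>x\<in>space B. indicator A x = tensor_val [(\<lambda>_. 1, A)] x"
      by (simp add: tensor_val_def)
    ultimately have "V.approx (indicator A)" by (intro V.approx_V) blast
    thus "A \<in> V.approx_sets" using D_sub(1)[OF A] by (simp add: V.approx_sets_def)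
  qed
  have "sets (P o') \<subseteq> V.approx_sets"
    using sig[of "sets S \<union> sets D"] SV DV gen unfolding jointly_generate_def by simp
  from V.approx_all[OF this f] obtain g where g: "g \<in> ?V" "(\<integral>x. \<bar>f x - g x\<bar> \<partial>P o') < \<epsilon>"
    using \<open>\<epsilon> > 0\<close> by (rule V.approxD)
  then obtain xs where xs: "admissible xs" "\<And>x. x \<in> space B \<Longrightarrow> g x = tensor_val xs x" by blast
  have "(\<integral>x. \<bar>f x - tensor_val xs x\<bar> \<partial>P o') = (\<integral>x. \<bar>f x - g x\<bar> \<partial>P o')"
    by (rule Bochner_Integration.integral_cong) (auto simp: xs(2))
  thus ?thesis using that[OF xs(1)] g(2) by simp
qed

end

subsection \<open>Coding finitely many events by one random variable\<close>

text \<open>The finite range matters as much as the separation: on finitely many reals every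
  function is continuous, so membership can be read off \<open>\<xi>\<close> continuously.\<close>

lemma encode_events:
  assumes "finite \<A>" "\<A> \<subseteq> sets M"
  shows "\<exists>\<xi>\<in>borel_measurable M. finite (\<xi> ` space M) \<and>
    (\<forall>A\<in>\<A>. \<forall>x\<in>space M. \<forall>y\<in>space M. \<xi> x = (\<xi> y :: real) \<longrightarrow> (x \<in> A \<longleftrightarrow> y \<in> A))"
  using assms
proof (induction \<A> rule: finite_induct)
  case empty
  show ?case by (rule bexI[of _ "\<lambda>_. 0"]) (auto simp: image_constant_conv)
next
  case (insert A \<A>)
  have "\<A> \<subseteq> sets M" using insert.prems by simp
  from insert.IH[OF this] obtain \<xi> :: "'a \<Rightarrow> real" where \<xi>: "\<xi> \<in> borel_measurable M" "finite (\<xi> ` space M)"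
    and sep': "\<forall>A\<in>\<A>. \<forall>x\<in>space M. \<forall>y\<in>space M. \<xi> x = \<xi> y \<longrightarrow> (x \<in> A \<longleftrightarrow> y \<in> A)"
    by (elim bexE conjE)
  have sep: "x \<in> A \<longleftrightarrow> y \<in> A" if "A \<in> \<A>" "x \<in> space M" "y \<in> space M" "\<xi> x = \<xi> y" for A x y
    by (rule sep'[rule_format, OF that])
  have A: "A \<in> sets M" using insert.prems by simp
  obtain c where c: "\<And>x. x \<in> space M \<Longrightarrow> \<bar>\<xi> x\<bar> \<le> c"
    using finite_imp_bounded[OF \<xi>(2)] by (auto simp: bounded_iff)
  \<comment> \<open>Two old values differ by at most \<open>2 * c\<close>, so the shift
    \<open>2 * c + 1\<close> is too large to be mistaken for such a difference: the new value
    determines both the old one and membership in \<open>A\<close>.\<close>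
  let ?\<xi> = "\<lambda>x. \<xi> x + (2 * c + 1) * indicator A x"
  have eq: "(x \<in> A \<longleftrightarrow> y \<in> A) \<and> \<xi> x = \<xi> y" if "x \<in> space M" "y \<in> space M" "?\<xi> x = ?\<xi> y" for x y
    using that(3) c[OF that(1)] c[OF that(2)] by (cases "x \<in> A"; cases "y \<in> A") auto
  show ?case
  proof (intro bexI[of _ ?\<xi>] conjI ballI impI)
    have "?\<xi> ` space M \<subseteq> (\<lambda>(s, t). s + (2 * c + 1) * t) ` (\<xi> ` space M \<times> {0, 1})"
      by (auto simp: indicator_def image_iff)
    thus "finite (?\<xi> ` space M)" by (rule finite_subset) (use \<xi>(2) in auto)
    show "?\<xi> \<in> borel_measurable M" using \<xi>(1) A by auto
    fix A' x y assume *: "A' \<in> insert A \<A>" "x \<in> space M" "y \<in> space M" "?\<xi> x = ?\<xi> y"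
    show "x \<in> A' \<longleftrightarrow> y \<in> A'"
    proof (cases "A' = A")
      case True
      thus ?thesis using eq[OF *(2-4)] by simp
    next
      case False
      hence "A' \<in> \<A>" using *(1) by simp
      thus ?thesis using eq[OF *(2-4)] by (intro sep *(2,3)) auto
    qed
  qed
qed

text \<open>Tietze extension from a finite set of reals. An extension to the whole line is needed
  because the variables converging to \<open>\<xi>\<close> may take any real value, and weak
  convergence tests only continuous functions.\<close>

lemma decode_event:
  fixes \<xi> :: "'a \<Rightarrow> real"
  assumes fin: "finite (\<xi> ` X)"
    and sep: "\<And>x y. x \<in> X \<Longrightarrow> y \<in> X \<Longrightarrow> \<xi> x = \<xi> y \<Longrightarrow> x \<in> A \<longleftrightarrow> y \<in> A"
  obtains \<psi> :: "real \<Rightarrow> real" where "continuous_on UNIV \<psi>" "\<And>z. \<bar>\<psi> z\<bar> \<le> 1"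
    "\<And>x. x \<in> X \<Longrightarrow> \<psi> (\<xi> x) = indicator A x"
proof -
  let ?g = "indicator (\<xi> ` (X \<inter> A)) :: real \<Rightarrow> real"
  obtain \<psi> where \<psi>: "continuous_on UNIV \<psi>" "\<And>z. z \<in> \<xi> ` X \<Longrightarrow> \<psi> z = ?g z" "\<And>z. z \<in> UNIV \<Longrightarrow> norm (\<psi> z) \<le> 1"
  proof (rule Tietze[of "\<xi> ` X" ?g UNIV 1])
    show "continuous_on (\<xi> ` X) ?g" using fin by (rule continuous_on_finite)
    show "closedin (top_of_set UNIV) (\<xi> ` X)" using fin by (simp add: finite_imp_closed)
  qed (auto simp: indicator_def)
  have "\<psi> (\<xi> x) = indicator A x" if "x \<in> X" for x
  proof -
    have "\<xi> x \<in> \<xi> ` (X \<inter> A) \<longleftrightarrow> x \<in> A"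
    proof
      assume "\<xi> x \<in> \<xi> ` (X \<inter> A)"
      then obtain y where "y \<in> X" "y \<in> A" "\<xi> x = \<xi> y" by blast
      thus "x \<in> A" using sep[OF \<open>x \<in> X\<close>, of y] by simp
    qed (use that in blast)
    thus ?thesis using \<psi>(2)[of "\<xi> x"] that by (simp add: indicator_def)
  qed
  thus ?thesis using that \<psi>(1,3) by simp
qed

subsection \<open>A modulus of continuity for bounded continuous test functions\<close>

text \<open>A bounded continuous \<open>f\<close> need not be uniformly continuous, but it is so on
  compact boxes; the term with \<open>\<kappa>\<close> pays for large \<open>x\<close> and the term
  with \<open>K\<close> for distant \<open>y\<close>. Both are linear, so after integration they
  involve only first absolute moments and distances in mean.\<close>

lemma bounded_continuous_modulus:
  fixes f :: "('c \<Rightarrow> real) \<Rightarrow> real"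
  assumes cont: "continuous_on UNIV f" and bd: "\<And>u. \<bar>f u\<bar> \<le> C" and I: "finite I"
    and "\<delta> > 0" "\<kappa> > 0"
  shows "\<exists>K\<ge>0. \<forall>x y. \<bar>f (restrict x I) - f (restrict y I)\<bar>
    \<le> \<delta> + \<kappa> * (\<Sum>a\<in>I. \<bar>x a\<bar>) + K * (\<Sum>a\<in>I. \<bar>x a - y a\<bar>)"
proof -
  have C0: "C \<ge> 0" using bd[of undefined] by linarith
  have f2: "\<bar>f u - f v\<bar> \<le> 2 * C" for u v using bd[of u] bd[of v] by linarith
  \<comment> \<open>If the absolute sum of \<open>x\<close> reaches \<open>M - 1\<close>, the
    \<open>\<kappa>\<close> term alone exceeds the oscillation \<open>2 * C\<close>. The extra one
    leaves room for \<open>y\<close>, at distance less than one from \<open>x\<close>.\<close>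
  define M where "M = 2 * C / \<kappa> + 1"
  \<comment> \<open>Off \<open>I\<close>, restricted functions take the value
    \<open>undefined\<close>; freezing these coordinates there makes the box compact by Tychonoff's
    theorem.\<close>
  let ?S = "\<lambda>a. if a \<in> I then {-M..M} else {undefined}"
  let ?Box = "PiE UNIV ?S"
  have "compactin (product_topology (\<lambda>_. euclidean) UNIV) ?Box"
    by (subst compactin_PiE) auto
  hence "compact ?Box" by (simp add: euclidean_product_topology)
  hence c2: "compact (?Box \<times> ?Box)" by (intro compact_Times)
  have cf: "continuous_on UNIV (\<lambda>p. \<bar>f (fst p) - f (snd p)\<bar>)"
    by (intro continuous_intros continuous_on_compose2[OF cont]) auto
  let ?Z = "?Box \<times> ?Box \<inter> {p. \<delta> \<le> \<bar>f (fst p) - f (snd p)\<bar>}"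
  have "closed {p. \<delta> \<le> \<bar>f (fst p) - f (snd p)\<bar>}"
    by (rule closed_Collect_le[OF continuous_on_const cf])
  hence cZ: "compact ?Z" using c2 by (intro compact_Int_closed)
  let ?s = "\<lambda>p. \<Sum>a\<in>I. \<bar>fst p a - snd p a\<bar> :: real"
  have cs: "continuous_on ?Z ?s"
    by (intro continuous_intros continuous_on_compose2[OF continuous_on_product_coordinates]) auto
  \<comment> \<open>On the compact set of pairs in the box where \<open>f\<close> differs by at
    least \<open>\<delta>\<close>, the distance attains its minimum. It is not zero, since points of
    the box that agree on \<open>I\<close> are equal.\<close>
  obtain r where r: "r > 0" "\<And>p. p \<in> ?Z \<Longrightarrow> r \<le> ?s p"
  proof (cases "?Z = {}")
    case False
    obtain p where p: "p \<in> ?Z" "\<And>q. q \<in> ?Z \<Longrightarrow> ?s p \<le> ?s q"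
      using continuous_attains_inf[OF cZ False cs] by blast
    have "?s p > 0"
    proof (rule ccontr)
      assume "\<not> ?s p > 0"
      moreover have "?s p \<ge> 0" by (intro sum_nonneg) auto
      ultimately have "?s p = 0" by linarith
      hence eq: "fst p a = snd p a" if "a \<in> I" for a
        using that I by (subst (asm) sum_nonneg_eq_0_iff) auto
      have "fst p a = snd p a" for a
      proof (cases "a \<in> I")
        case False
        have "fst p \<in> ?Box" "snd p \<in> ?Box" using p(1) by auto
        thus ?thesis using False by (auto dest!: PiE_mem[where x = a])
      qed (rule eq)
      hence "fst p = snd p" by (rule ext)
      thus False using p(1) \<open>\<delta> > 0\<close> by auto
    qed
    thus ?thesis using that p(2) by blast
  qed (use that[of 1] in auto)
  define K where "K = 2 * C / min r 1"
  have K0: "K \<ge> 0" using C0 r(1) by (simp add: K_def)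
  have "\<bar>f (restrict x I) - f (restrict y I)\<bar>
    \<le> \<delta> + \<kappa> * (\<Sum>a\<in>I. \<bar>x a\<bar>) + K * (\<Sum>a\<in>I. \<bar>x a - y a\<bar>)" for x y
  proof -
    let ?A = "\<Sum>a\<in>I. \<bar>x a\<bar>" and ?D = "\<Sum>a\<in>I. \<bar>x a - y a\<bar>"
    have nn: "?A \<ge> 0" "?D \<ge> 0" by (auto intro!: sum_nonneg)
    hence nn': "\<kappa> * ?A \<ge> 0" "K * ?D \<ge> 0" using \<open>\<kappa> > 0\<close> K0 by auto
    show ?thesis
    proof (cases "?A \<ge> M - 1 \<or> ?D \<ge> min r 1")
      case True
      thus ?thesis
      proof
        assume "?A \<ge> M - 1"
        hence "\<kappa> * ?A \<ge> 2 * C" using \<open>\<kappa> > 0\<close> by (simp add: M_def field_simps)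
        thus ?thesis using f2[of "restrict x I" "restrict y I"] nn' \<open>\<delta> > 0\<close> by linarith
      next
        assume "?D \<ge> min r 1"
        hence "K * ?D \<ge> K * min r 1" using K0 by (rule mult_left_mono)
        hence "K * ?D \<ge> 2 * C" using r(1) by (simp add: K_def)
        thus ?thesis using f2[of "restrict x I" "restrict y I"] nn' \<open>\<delta> > 0\<close> by linarith
      qed
    next
      case False
      have "\<bar>x a\<bar> \<le> M \<and> \<bar>y a\<bar> \<le> M" if "a \<in> I" for a
      proof -
        have "\<bar>x a\<bar> \<le> ?A" "\<bar>x a - y a\<bar> \<le> ?D"
          using that I member_le_sum[of a I "\<lambda>a. \<bar>x a\<bar>"] member_le_sum[of a I "\<lambda>a. \<bar>x a - y a\<bar>"]
          by auto
        thus ?thesis using False by linarith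
      qed
      hence "restrict x I \<in> ?Box" "restrict y I \<in> ?Box" by (fastforce simp: abs_le_iff)+
      moreover have "?s (restrict x I, restrict y I) = ?D" by (auto intro!: sum.cong)
      ultimately have "\<not> \<delta> \<le> \<bar>f (restrict x I) - f (restrict y I)\<bar>"
        using r(2)[of "(restrict x I, restrict y I)"] False by auto
      thus ?thesis using nn' by linarith
    qed
  qed
  thus ?thesis using K0 by blast
qed

text \<open>Here the index type is countable, so measurable coordinates do make a Borel measurable
  map into the product.\<close>

lemma measurable_restrict_continuous:
  fixes f :: "('c :: countable \<Rightarrow> real) \<Rightarrow> real"
  assumes f: "continuous_on UNIV f" and g: "\<And>a. a \<in> I \<Longrightarrow> (\<lambda>x. g x a) \<in> borel_measurable M"
  shows "(\<lambda>x. f (restrict (g x) I)) \<in> borel_measurable M"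
proof -
  have "(\<lambda>x. restrict (g x) I) \<in> borel_measurable M"
  proof (rule measurable_coordinatewise_then_product)
    show "(\<lambda>x. restrict (g x) I a) \<in> borel_measurable M" for a
      using g[of a] by (cases "a \<in> I") simp_all
  qed
  thus ?thesis
    by (rule measurable_compose[OF _ borel_measurable_continuous_onI[OF f]])
qed

text \<open>Only \<open>X\<close> carries a moment bound; \<open>Y\<close> enters through its
  distance to \<open>X\<close>.\<close>

lemma (in prob_space) expectation_modulus:
  fixes f :: "('c :: countable \<Rightarrow> real) \<Rightarrow> real" and \<delta> \<kappa> K \<epsilon> C :: real
  assumes f: "continuous_on UNIV f" "\<And>u. \<bar>f u\<bar> \<le> C"
    and mod: "\<And>x y. \<bar>f (restrict x I) - f (restrict y I)\<bar>
      \<le> \<delta> + \<kappa> * (\<Sum>a\<in>I. \<bar>x a\<bar>) + K * (\<Sum>a\<in>I. \<bar>x a - y a\<bar>)"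
    and nonneg: "\<kappa> \<ge> 0" "K \<ge> 0"
    and X: "\<And>a. a \<in> I \<Longrightarrow> integrable M (\<lambda>x. X x a)" "\<And>a. a \<in> I \<Longrightarrow> (\<integral>x. \<bar>X x a\<bar> \<partial>M) \<le> 1"
    and Y: "\<And>a. a \<in> I \<Longrightarrow> integrable M (\<lambda>x. Y x a)" "\<And>a. a \<in> I \<Longrightarrow> (\<integral>x. \<bar>X x a - Y x a\<bar> \<partial>M) \<le> \<epsilon>"
  shows "\<bar>(\<integral>x. f (restrict (X x) I) \<partial>M) - (\<integral>x. f (restrict (Y x) I) \<partial>M)\<bar>
    \<le> \<delta> + \<kappa> * card I + K * (card I * \<epsilon>)"
proof -
  have meas: "(\<lambda>x. f (restrict (X x) I)) \<in> borel_measurable M" "(\<lambda>x. f (restrict (Y x) I)) \<in> borel_measurable M"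
    using X(1) Y(1) by (auto intro!: measurable_restrict_continuous[OF f(1)])
  have int: "integrable M (\<lambda>x. f (restrict (X x) I))" "integrable M (\<lambda>x. f (restrict (Y x) I))"
    using f(2) meas by (auto intro!: integrable_const_bound[of _ C])
  have i1: "integrable M (\<lambda>x. \<kappa> * (\<Sum>a\<in>I. \<bar>X x a\<bar>))" "integrable M (\<lambda>x. K * (\<Sum>a\<in>I. \<bar>X x a - Y x a\<bar>))"
    using X(1) Y(1) by auto
  have "\<bar>(\<integral>x. f (restrict (X x) I) \<partial>M) - (\<integral>x. f (restrict (Y x) I) \<partial>M)\<bar>
      = \<bar>\<integral>x. f (restrict (X x) I) - f (restrict (Y x) I) \<partial>M\<bar>"
    using int by simp
  also have "\<dots> \<le> (\<integral>x. \<bar>f (restrict (X x) I) - f (restrict (Y x) I)\<bar> \<partial>M)"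
    by (rule integral_abs_bound)
  also have "\<dots> \<le> (\<integral>x. \<delta> + \<kappa> * (\<Sum>a\<in>I. \<bar>X x a\<bar>) + K * (\<Sum>a\<in>I. \<bar>X x a - Y x a\<bar>) \<partial>M)"
    by (rule Bochner_Integration.integral_mono) (use int i1 mod in auto)
  also have "\<dots> = \<delta> + \<kappa> * (\<Sum>a\<in>I. \<integral>x. \<bar>X x a\<bar> \<partial>M) + K * (\<Sum>a\<in>I. \<integral>x. \<bar>X x a - Y x a\<bar> \<partial>M)"
    using i1 X(1) Y(1) by (simp add: prob_space Bochner_Integration.integral_sum)
  also have "\<dots> \<le> \<delta> + \<kappa> * (\<Sum>a\<in>I. 1) + K * (\<Sum>a\<in>I. \<epsilon>)"
    using X(2) Y(2) nonneg by (intro add_mono mult_left_mono sum_mono) auto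
  finally show ?thesis by simp
qed

subsection \<open>Passage to the limit\<close>

context nuisance_experiment
begin

lemma integrable_L: "integrable (P o') (lik_ratio (P q) (P o'))"
  by (rule integrable_lik)

lemma cond_lik_ratio_integrable: "integrable (P o') (cond_lik_ratio (P q) (P o') D)"
  unfolding cond_lik_ratio_def by (rule cD.real_cond_exp_int(1)[OF integrable_L])

text \<open>A first-moment bound that is the same for all experiments; it provides the tightness
  needed in \<open>expectation_modulus\<close>.\<close>

lemma cond_lik_ratio_abs: "(\<integral>x. \<bar>cond_lik_ratio (P q) (P o') D x\<bar> \<partial>P o') = 1"
proof -
  have "AE x in P o'. \<bar>cond_lik_ratio (P q) (P o') D x\<bar> = cond_lik_ratio (P q) (P o') D x"
    using cD.real_cond_exp_pos[of "lik_ratio (P q) (P o')"] unfolding cond_lik_ratio_def by auto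
  hence "(\<integral>x. \<bar>cond_lik_ratio (P q) (P o') D x\<bar> \<partial>P o') = (\<integral>x. cond_lik_ratio (P q) (P o') D x \<partial>P o')"
    by (intro integral_cong_AE) (use cond_lik_ratio_integrable in auto)
  also have "\<dots> = 1"
    unfolding cond_lik_ratio_def using cD.real_cond_exp_int(2)[OF integrable_L] integral_lik_1 by simp
  finally show ?thesis .
qed

lemma truncated_lik_ratio:
  assumes "\<epsilon> > 0"
  obtains M where "M \<ge> 0" "(\<integral>x. min (lik_ratio (P q) (P o') x) M \<partial>P o') > 1 - \<epsilon>"
proof -
  let ?L = "lik_ratio (P q) (P o')"
  have "(\<lambda>m. \<integral>x. min (?L x) (real m) \<partial>P o') \<longlonglongrightarrow> (\<integral>x. ?L x \<partial>P o')"
  proof (rule integral_dominated_convergence[where w = ?L])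
    show "AE x in P o'. (\<lambda>m. min (?L x) (real m)) \<longlonglongrightarrow> ?L x"
    proof (rule AE_I2)
      fix x
      obtain N where "?L x \<le> real N" using real_arch_simple by blast
      hence "\<forall>\<^sub>F m in sequentially. min (?L x) (real m) = ?L x"
        by (auto simp: eventually_sequentially intro!: exI[of _ N])
      thus "(\<lambda>m. min (?L x) (real m)) \<longlonglongrightarrow> ?L x" by (rule tendsto_eventually)
    qed
  qed (auto intro: integrable_L)
  hence "\<forall>\<^sub>F m in sequentially. (\<integral>x. min (?L x) (real m) \<partial>P o') > 1 - \<epsilon>"
    using assms integral_lik_1[of o' q] by (intro order_tendstoD(1)) auto
  then obtain m where "(\<integral>x. min (?L x) (real m) \<partial>P o') > 1 - \<epsilon>"
    by (auto simp: eventually_sequentially)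
  thus ?thesis using that[of "real m"] by simp
qed

text \<open>The part cut off is nonnegative and has mean one minus the truncated mean, hence less
  than \<open>\<epsilon>\<close>; the other \<open>\<epsilon>\<close> is the distance of the
  truncated ratio from \<open>t\<close>.\<close>

lemma lik_ratio_truncation:
  assumes t: "integrable (P o') t"
    and M: "(\<integral>x. min (lik_ratio (P q) (P o') x) M \<partial>P o') > 1 - \<epsilon>"
    and close: "(\<integral>x. \<bar>min (lik_ratio (P q) (P o') x) M - t x\<bar> \<partial>P o') < \<epsilon>"
  shows "(\<integral>x. \<bar>lik_ratio (P q) (P o') x - t x\<bar> \<partial>P o') \<le> 2 * \<epsilon>"
proof -
  let ?L = "lik_ratio (P q) (P o')"
  interpret prob_space "P o'" by (rule prob_space_P)
  have int: "integrable (P o') (\<lambda>x. min (?L x) M)" using integrable_L[of q] by auto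
  have "(\<integral>x. \<bar>?L x - t x\<bar> \<partial>P o') \<le> (\<integral>x. (?L x - min (?L x) M) + \<bar>min (?L x) M - t x\<bar> \<partial>P o')"
    by (rule Bochner_Integration.integral_mono) (use integrable_L[of q] int t in auto)
  also have "\<dots> = 1 - (\<integral>x. min (?L x) M \<partial>P o') + (\<integral>x. \<bar>min (?L x) M - t x\<bar> \<partial>P o')"
    using integrable_L[of q] int t integral_lik_1[of o' q] by simp
  also have "\<dots> \<le> 2 * \<epsilon>" using M close by linarith
  finally show ?thesis .
qed

lemma integrable_tensor:
  assumes \<psi>: "\<And>A. continuous_on UNIV (\<psi> A)" "\<And>A z. \<bar>\<psi> A z\<bar> \<le> 1"
    and \<xi>: "\<xi> \<in> borel_measurable D"
  shows "integrable (P o') (\<lambda>x. tensor_sum c (\<lambda>A. \<psi> A (\<xi> x)) xs)"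
proof -
  have \<psi>m: "(\<lambda>x. \<psi> A (\<xi> x)) \<in> borel_measurable D" for A
    by (rule measurable_compose[OF \<xi> borel_measurable_continuous_onI[OF \<psi>(1)]])
  have m: "(\<lambda>x. tensor_sum c (\<lambda>A. \<psi> A (\<xi> x)) xs) \<in> borel_measurable (P o')"
    using \<psi>m by (intro measurable_tensor_sum measurable_from_subalg[OF subalg_P[OF subD]]) auto
  have "\<exists>C. \<forall>x\<in>UNIV. \<bar>tensor_sum c (\<lambda>A. \<psi> A (\<xi> x)) xs\<bar> \<le> C"
    by (rule tensor_sum_bounded) (use \<psi>(2) in auto)
  then obtain C where "\<And>x. \<bar>tensor_sum c (\<lambda>A. \<psi> A (\<xi> x)) xs\<bar> \<le> C" by blast
  thus ?thesis using m by (intro cD.integrable_const_bound[of _ C]) auto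
qed

text \<open>By independence the sum with averaged coefficients is the conditional expectation of the
  sum on the right, so the contraction in mean applies.\<close>

lemma cond_lik_ratio_dist:
  assumes xs: "\<forall>p\<in>set xs. cyl (range \<nu>) (fst p)"
    and \<psi>: "\<And>A. continuous_on UNIV (\<psi> A)" "\<And>A z. \<bar>\<psi> A z\<bar> \<le> 1"
    and \<xi>: "\<xi> \<in> borel_measurable D"
  shows "(\<integral>x. \<bar>cond_lik_ratio (P q) (P o') D x
        - tensor_sum (\<lambda>\<Phi>. \<integral>y. \<Phi> (R y) \<partial>P o') (\<lambda>A. \<psi> A (\<xi> x)) xs\<bar> \<partial>P o')
      \<le> (\<integral>x. \<bar>lik_ratio (P q) (P o') x
        - tensor_sum (\<lambda>\<Phi>. \<Phi> (R x)) (\<lambda>A. \<psi> A (\<xi> x)) xs\<bar> \<partial>P o')" (is "?l \<le> ?r")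
proof -
  let ?t = "\<lambda>x. tensor_sum (\<lambda>\<Phi>. \<Phi> (R x)) (\<lambda>A. \<psi> A (\<xi> x)) xs"
  let ?h = "\<lambda>x. tensor_sum (\<lambda>\<Phi>. \<integral>y. \<Phi> (R y) \<partial>P o') (\<lambda>A. \<psi> A (\<xi> x)) xs"
  have \<psi>m: "(\<lambda>x. \<psi> A (\<xi> x)) \<in> borel_measurable D" for A
    by (rule measurable_compose[OF \<xi> borel_measurable_continuous_onI[OF \<psi>(1)]])
  have "\<exists>C. \<forall>x\<in>space B. \<bar>\<psi> A (\<xi> x)\<bar> \<le> C" for A using \<psi>(2) by blast
  note ce = cond_exp_tensor_sum[of xs "\<lambda>x A. \<psi> A (\<xi> x)", OF xs \<psi>m this]
  have hint: "integrable (P o') ?h" by (rule integrable_tensor[OF \<psi> \<xi>])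
  have "?l = (\<integral>x. \<bar>cond_lik_ratio (P q) (P o') D x - real_cond_exp (P o') D ?t x\<bar> \<partial>P o')"
  proof (rule integral_cong_AE)
    show "AE x in P o'. \<bar>cond_lik_ratio (P q) (P o') D x - ?h x\<bar>
        = \<bar>cond_lik_ratio (P q) (P o') D x - real_cond_exp (P o') D ?t x\<bar>"
      using ce(2) by eventually_elim simp
  qed (use cond_lik_ratio_integrable[of q] hint cD.real_cond_exp_int(1)[OF ce(1)] in auto)
  also have "\<dots> \<le> ?r"
    unfolding cond_lik_ratio_def by (rule cond_exp_L1_dist[OF subD integrable_L ce(1)])
  finally show ?thesis .
qed

end

lemma tensor_sum_diff_le:
  assumes "\<And>A. \<bar>a A\<bar> \<le> 1"
  shows "\<bar>tensor_sum c a xs - tensor_sum c' a xs\<bar> \<le> tensor_sum (\<lambda>\<Phi>. \<bar>c \<Phi> - c' \<Phi>\<bar>) (\<lambda>_. 1) xs"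
proof (induction xs)
  case (Cons y xs)
  obtain \<Phi> A where y: "y = (\<Phi>, A)" by force
  have "\<bar>c \<Phi> * a A - c' \<Phi> * a A\<bar> \<le> \<bar>c \<Phi> - c' \<Phi>\<bar>"
    using assms[of A] by (auto simp: left_diff_distrib[symmetric] abs_mult intro!: mult_right_le_one_le)
  thus ?case using Cons.IH by (simp add: y)
qed simp

section \<open>The sequence of experiments together with its limit\<close>

locale nuisance_convergence = lim: nuisance_experiment B P \<nu> o' S D
  for B :: "'a measure" and P :: "'i \<Rightarrow> 'a measure" and \<nu> :: "'j \<Rightarrow> 'i" and o' :: 'i and S D +
  fixes Bn :: "nat \<Rightarrow> 'b measure" and Pn :: "nat \<Rightarrow> 'i \<Rightarrow> 'b measure" and Sn Dn :: "nat \<Rightarrow> 'b measure"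
  assumes nuisance_n: "nuisance_experiment (Bn n) (Pn n) \<nu> o' (Sn n) (Dn n)"
begin

sublocale E: nuisance_experiment "Bn n" "Pn n" \<nu> o' "Sn n" "Dn n" for n
  by (rule nuisance_n)

text \<open>A function that looks only at coordinates in \<open>J\<close> does not distinguish
  \<open>lik_vector\<close> from the full vector of ratios.\<close>

lemma test_function_converges:
  fixes F :: "('i \<Rightarrow> real) \<times> real \<Rightarrow> real"
  assumes conv: "rv_converges_weakly Pn P o' \<xi>n \<xi>"
    and F: "continuous_on UNIV F" "\<And>p. \<bar>F p\<bar> \<le> C"
    and J: "finite J" "\<And>u v z. (\<forall>i\<in>J. u i = v i) \<Longrightarrow> F (u, z) = F (v, z)"
  shows "(\<lambda>n. \<integral>x. F (E.R n x, \<xi>n n x) \<partial>Pn n o') \<longlonglongrightarrow> (\<integral>x. F (lim.R x, \<xi> x) \<partial>P o')"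
proof -
  have b: "bounded (range F)" using F(2) by (auto simp: bounded_iff)
  have 1: "F (lik_vector (Pn n) o' J x, z) = F (E.R n x, z)" for n x z
    by (rule J(2)) (simp add: lik_vector_def E.R_def)
  have 2: "F (lik_vector P o' J x, z) = F (lim.R x, z)" for x z
    by (rule J(2)) (simp add: lik_vector_def lim.R_def)
  have "converges_in_distribution (\<lambda>n. Pn n o') (\<lambda>n x. (lik_vector (Pn n) o' J x, \<xi>n n x))
          (P o') (\<lambda>x. (lik_vector P o' J x, \<xi> x))"
    using conv J(1) unfolding rv_converges_weakly_def by blast
  hence "(\<lambda>n. \<integral>x. F (lik_vector (Pn n) o' J x, \<xi>n n x) \<partial>Pn n o')
      \<longlonglongrightarrow> (\<integral>x. F (lik_vector P o' J x, \<xi> x) \<partial>P o')"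
    using F(1) b unfolding converges_in_distribution_def by blast
  thus ?thesis unfolding 1 2 .
qed

text \<open>Two of the three \<open>\<epsilon>\<close> come from truncation and approximation, the
  third from replacing the coefficients of the \<open>n\<close>-th experiment by those of the
  limit.\<close>

lemma cond_lik_ratio_close:
  assumes conv: "rv_converges_weakly Pn P o' \<xi>n \<xi>" and \<xi>n: "\<And>n. \<xi>n n \<in> borel_measurable (Dn n)"
    and xs: "\<forall>p\<in>set xs. cyl (range \<nu>) (fst p)"
    and \<psi>: "\<And>A. continuous_on UNIV (\<psi> A)" "\<And>A z. \<bar>\<psi> A z\<bar> \<le> 1"
    and M: "M \<ge> 0" "(\<integral>x. min (lik_ratio (P q) (P o') x) M \<partial>P o') > 1 - \<epsilon>"
    and close: "(\<integral>x. \<bar>min (lik_ratio (P q) (P o') x) M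
        - tensor_sum (\<lambda>\<Phi>. \<Phi> (lim.R x)) (\<lambda>A. \<psi> A (\<xi> x)) xs\<bar> \<partial>P o') < \<epsilon>"
  shows "\<forall>\<^sub>F n in sequentially. (\<integral>x. \<bar>cond_lik_ratio (Pn n q) (Pn n o') (Dn n) x
        - tensor_sum (\<lambda>\<Phi>. \<integral>y. \<Phi> (lim.R y) \<partial>P o') (\<lambda>A. \<psi> A (\<xi>n n x)) xs\<bar> \<partial>Pn n o') \<le> 3 * \<epsilon>"
proof -
  let ?T = "\<lambda>p. tensor_sum (\<lambda>\<Phi>. \<Phi> (fst p)) (\<lambda>A. \<psi> A (snd p)) xs"
  \<comment> \<open>A test function must be bounded on the whole space, also where coordinates are
    negative, so \<open>max 0\<close> is added; on likelihood ratios it has no effect.\<close>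
  let ?F1 = "\<lambda>p. \<bar>max 0 (min (fst p q) M) - ?T p\<bar>"
  let ?F2 = "\<lambda>p :: ('i \<Rightarrow> real) \<times> real. max 0 (min (fst p q) M)"
  have cyl: "cyl (range \<nu>) \<Phi>" if "(\<Phi>, A) \<in> set xs" for \<Phi> A using xs that by force
  have contq: "continuous_on UNIV (\<lambda>p :: ('i \<Rightarrow> real) \<times> real. fst p q)"
    by (rule continuous_on_compose2[OF continuous_on_product_coordinates]) (auto intro: continuous_intros)
  have contT: "continuous_on UNIV ?T"
  proof (rule continuous_on_tensor_sum)
    fix \<Phi> A assume "(\<Phi>, A) \<in> set xs"
    show "continuous_on UNIV (\<lambda>p :: ('i \<Rightarrow> real) \<times> real. \<Phi> (fst p))"
      by (rule continuous_on_compose2[OF cyl_continuous[OF cyl[OF \<open>(\<Phi>, A) \<in> set xs\<close>]]])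
        (auto intro: continuous_intros)
    show "continuous_on UNIV (\<lambda>p :: ('i \<Rightarrow> real) \<times> real. \<psi> A (snd p))"
      by (rule continuous_on_compose2[OF \<psi>(1)]) (auto intro: continuous_intros)
  qed
  have "\<exists>C. \<forall>p\<in>UNIV. \<bar>?T p\<bar> \<le> C"
    by (rule tensor_sum_bounded) (use cyl_bounded[OF cyl] \<psi>(2) in blast)
  then obtain C where C: "\<And>p. \<bar>?T p\<bar> \<le> C" by blast
  have "\<forall>\<Phi>\<in>fst ` set xs. \<exists>J. finite J \<and> (\<forall>u v. (\<forall>i\<in>J. u i = v i) \<longrightarrow> \<Phi> u = \<Phi> v)"
    using xs by (auto intro!: cyl_finite_support)
  then obtain J where J: "\<And>\<Phi>. \<Phi> \<in> fst ` set xs \<Longrightarrow> finite (J \<Phi>)"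
    "\<And>\<Phi> u v. \<Phi> \<in> fst ` set xs \<Longrightarrow> (\<forall>i\<in>J \<Phi>. u i = v i) \<Longrightarrow> \<Phi> u = \<Phi> v"
    by metis
  let ?J = "insert q (\<Union>\<Phi>\<in>fst ` set xs. J \<Phi>)"
  have finJ: "finite ?J" using J(1) by auto
  have T_dep: "?T (u, z) = ?T (v, z)" if eq: "\<forall>i\<in>?J. u i = v i" for u v z
  proof (rule tensor_sum_cong)
    fix \<Phi> A assume mem: "(\<Phi>, A) \<in> set xs"
    hence "\<Phi> \<in> fst ` set xs" by force
    hence "\<Phi> u = \<Phi> v" using eq by (intro J(2)) auto
    thus "\<Phi> (fst (u, z)) * \<psi> A (snd (u, z)) = \<Phi> (fst (v, z)) * \<psi> A (snd (v, z))" by simp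
  qed
  have F1b: "\<bar>?F1 p\<bar> \<le> M + C" for p
  proof -
    have "0 \<le> max 0 (min (fst p q) M)" "max 0 (min (fst p q) M) \<le> M" using M(1) by auto
    thus ?thesis using C[of p] by linarith
  qed
  have lim1: "(\<lambda>n. \<integral>x. ?F1 (E.R n x, \<xi>n n x) \<partial>Pn n o') \<longlonglongrightarrow> (\<integral>x. ?F1 (lim.R x, \<xi> x) \<partial>P o')"
  proof (rule test_function_converges[OF conv _ F1b finJ])
    show "continuous_on UNIV ?F1" by (intro continuous_intros contq contT)
    show "?F1 (u, z) = ?F1 (v, z)" if "\<forall>i\<in>?J. u i = v i" for u v z
      using T_dep[OF that, of z] that by simp
  qed
  have lim2: "(\<lambda>n. \<integral>x. ?F2 (E.R n x, \<xi>n n x) \<partial>Pn n o') \<longlonglongrightarrow> (\<integral>x. ?F2 (lim.R x, \<xi> x) \<partial>P o')"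
  proof (rule test_function_converges[OF conv, where C = M and J = "{q}"])
    show "continuous_on UNIV ?F2" by (intro continuous_intros contq)
  qed (use M(1) in auto)
  have lim3: "(\<lambda>n. \<integral>x. \<Phi> (E.R n x) \<partial>Pn n o') \<longlonglongrightarrow> (\<integral>x. \<Phi> (lim.R x) \<partial>P o')" if mem: "(\<Phi>, A) \<in> set xs" for \<Phi> A
  proof -
    have "\<Phi> \<in> fst ` set xs" using mem by force
    obtain C where C: "\<And>u. \<bar>\<Phi> u\<bar> \<le> C" using cyl_bounded[OF cyl[OF mem]] by blast
    show ?thesis
    proof (rule test_function_converges[OF conv, where F = "\<lambda>p. \<Phi> (fst p)" and C = C and J = "J \<Phi>", simplified])
      show "continuous_on UNIV (\<lambda>p :: ('i \<Rightarrow> real) \<times> real. \<Phi> (fst p))"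
        by (rule continuous_on_compose2[OF cyl_continuous[OF cyl[OF mem]]]) (auto intro: continuous_intros)
      show "finite (J \<Phi>)" using \<open>\<Phi> \<in> fst ` set xs\<close> by (rule J(1))
      show "\<Phi> u = \<Phi> v" if "\<forall>i\<in>J \<Phi>. u i = v i" for u v
        using \<open>\<Phi> \<in> fst ` set xs\<close> that by (rule J(2))
    qed (rule C)
  qed
  let ?d = "\<lambda>n. tensor_sum (\<lambda>\<Phi>. \<bar>(\<integral>y. \<Phi> (E.R n y) \<partial>Pn n o') - (\<integral>y. \<Phi> (lim.R y) \<partial>P o')\<bar>) (\<lambda>_. 1) xs"
  have "?d \<longlonglongrightarrow> tensor_sum (\<lambda>_. 0) (\<lambda>_. 1) xs"
  proof (rule tendsto_tensor_sum)
    fix \<Phi> A assume "(\<Phi>, A) \<in> set xs"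
    from tendsto_rabs[OF tendsto_diff[OF lim3[OF this] tendsto_const[of "\<integral>y. \<Phi> (lim.R y) \<partial>P o'"]]]
    show "(\<lambda>n. \<bar>(\<integral>y. \<Phi> (E.R n y) \<partial>Pn n o') - (\<integral>y. \<Phi> (lim.R y) \<partial>P o')\<bar>) \<longlonglongrightarrow> 0" by simp
  qed simp
  moreover have "tensor_sum (\<lambda>_. 0) (\<lambda>_. 1) xs = 0" by (simp add: tensor_sum_def case_prod_unfold)
  ultimately have limd: "?d \<longlonglongrightarrow> 0" by simp
  have "(\<integral>x. ?F1 (lim.R x, \<xi> x) \<partial>P o') < \<epsilon>"
    using close M(1) by (simp add: lim.R_def max_absorb2)
  \<comment> \<open>Being strict, the inequalities for the limit hold eventually along the
    sequence.\<close>
  hence ev1: "\<forall>\<^sub>F n in sequentially. (\<integral>x. ?F1 (E.R n x, \<xi>n n x) \<partial>Pn n o') < \<epsilon>"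
    using lim1 by (intro order_tendstoD(2))
  have "(\<integral>x. ?F2 (lim.R x, \<xi> x) \<partial>P o') > 1 - \<epsilon>"
    using M by (simp add: lim.R_def max_absorb2)
  hence ev2: "\<forall>\<^sub>F n in sequentially. (\<integral>x. ?F2 (E.R n x, \<xi>n n x) \<partial>Pn n o') > 1 - \<epsilon>"
    using lim2 by (intro order_tendstoD(1))
  have "0 \<le> (\<integral>x. ?F1 (lim.R x, \<xi> x) \<partial>P o')" by (intro integral_nonneg_AE) auto
  hence "\<epsilon> > 0" using \<open>(\<integral>x. ?F1 (lim.R x, \<xi> x) \<partial>P o') < \<epsilon>\<close> by linarith
  hence ev3: "\<forall>\<^sub>F n in sequentially. ?d n < \<epsilon>"
    using limd by (intro order_tendstoD(2))
  show ?thesis using ev1 ev2 ev3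
  proof eventually_elim
    fix n
    assume n1: "(\<integral>x. ?F1 (E.R n x, \<xi>n n x) \<partial>Pn n o') < \<epsilon>"
      and n2: "(\<integral>x. ?F2 (E.R n x, \<xi>n n x) \<partial>Pn n o') > 1 - \<epsilon>" and n3: "?d n < \<epsilon>"
    interpret prob_space "Pn n o'" by (rule E.prob_space_P)
    let ?L = "lik_ratio (Pn n q) (Pn n o')" and ?X = "cond_lik_ratio (Pn n q) (Pn n o') (Dn n)"
    let ?t = "\<lambda>x. tensor_sum (\<lambda>\<Phi>. \<Phi> (E.R n x)) (\<lambda>A. \<psi> A (\<xi>n n x)) xs"
    let ?hn = "\<lambda>x. tensor_sum (\<lambda>\<Phi>. \<integral>y. \<Phi> (E.R n y) \<partial>Pn n o') (\<lambda>A. \<psi> A (\<xi>n n x)) xs"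
    let ?h = "\<lambda>x. tensor_sum (\<lambda>\<Phi>. \<integral>y. \<Phi> (lim.R y) \<partial>P o') (\<lambda>A. \<psi> A (\<xi>n n x)) xs"
    have \<psi>m: "(\<lambda>x. \<psi> A (\<xi>n n x)) \<in> borel_measurable (Dn n)" for A
      by (rule measurable_compose[OF \<xi>n borel_measurable_continuous_onI[OF \<psi>(1)]])
    have "\<exists>C. \<forall>x\<in>space (Bn n). \<bar>\<psi> A (\<xi>n n x)\<bar> \<le> C" for A using \<psi>(2) by blast
    note tint = E.cond_exp_tensor_sum(1)[of xs "\<lambda>x A. \<psi> A (\<xi>n n x)", OF xs \<psi>m this]
    have F2: "?F2 (E.R n x, \<xi>n n x) = min (?L x) M" for x
      using M(1) by (simp add: E.R_def max_absorb2)
    have F1: "?F1 (E.R n x, \<xi>n n x) = \<bar>min (?L x) M - ?t x\<bar>" for x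
      using M(1) by (simp add: E.R_def max_absorb2)
    have "(\<integral>x. \<bar>?L x - ?t x\<bar> \<partial>Pn n o') \<le> 2 * \<epsilon>"
      by (rule E.lik_ratio_truncation[OF tint n2[unfolded F2] n1[unfolded F1, unfolded fst_conv snd_conv]])
    with E.cond_lik_ratio_dist[of xs \<psi> "\<xi>n n" n q, OF xs \<psi> \<xi>n]
    have *: "(\<integral>x. \<bar>?X x - ?hn x\<bar> \<partial>Pn n o') \<le> 2 * \<epsilon>" by linarith
    have hb: "\<bar>?hn x - ?h x\<bar> \<le> ?d n" for x by (rule tensor_sum_diff_le[OF \<psi>(2)])
    have hint: "integrable (Pn n o') (\<lambda>x. tensor_sum c (\<lambda>A. \<psi> A (\<xi>n n x)) xs)" for c
      by (rule E.integrable_tensor[OF \<psi> \<xi>n])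
    have Xint: "integrable (Pn n o') ?X" by (rule E.cond_lik_ratio_integrable)
    have "(\<integral>x. \<bar>?X x - ?h x\<bar> \<partial>Pn n o') \<le> (\<integral>x. \<bar>?X x - ?hn x\<bar> + ?d n \<partial>Pn n o')"
    proof (rule Bochner_Integration.integral_mono)
      show "\<bar>?X x - ?h x\<bar> \<le> \<bar>?X x - ?hn x\<bar> + ?d n" for x using hb[of x] by linarith
    qed (use Xint hint in auto)
    also have "\<dots> = (\<integral>x. \<bar>?X x - ?hn x\<bar> \<partial>Pn n o') + ?d n"
      using Xint hint prob_space by simp
    also have "\<dots> \<le> 3 * \<epsilon>" using * n3 by linarith
    finally show "(\<integral>x. \<bar>?X x - ?h x\<bar> \<partial>Pn n o') \<le> 3 * \<epsilon>" .
  qed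
qed

text \<open>The vector is compared with a fixed continuous function \<open>H\<close> of one real
  variable, evaluated at \<open>\<xi>n n\<close> along the sequence and at \<open>\<xi>\<close> in
  the limit; weak convergence connects these two.\<close>

lemma cond_lik_ratio_converges:
  fixes I :: "'c :: countable set" and p :: "'c \<Rightarrow> 'i"
  assumes minimal: "minimal_sufficient B (\<lambda>j. P (\<nu> j)) S" and gen: "jointly_generate B S D"
    and conv: "sigma_field_converges_weakly Pn P o' Dn D" and I: "finite I"
  shows "converges_in_distribution (\<lambda>n. Pn n o')
           (\<lambda>n x. restrict (\<lambda>a. cond_lik_ratio (Pn n (p a)) (Pn n o') (Dn n) x) I)
           (P o') (\<lambda>x. restrict (\<lambda>a. cond_lik_ratio (P (p a)) (P o') D x) I)"
  unfolding converges_in_distribution_def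
proof (intro allI impI, elim conjE)
  fix f :: "('c \<Rightarrow> real) \<Rightarrow> real"
  assume cont: "continuous_on UNIV f" and "bounded (range f)"
  then obtain C where C: "\<And>u. \<bar>f u\<bar> \<le> C" by (auto simp: bounded_iff)
  let ?Xn = "\<lambda>n x a. cond_lik_ratio (Pn n (p a)) (Pn n o') (Dn n) x"
  let ?X = "\<lambda>x a. cond_lik_ratio (P (p a)) (P o') D x"
  let ?an = "\<lambda>n. \<integral>x. f (restrict (?Xn n x) I) \<partial>Pn n o'" and ?a = "\<integral>x. f (restrict (?X x) I) \<partial>P o'"
  show "?an \<longlonglongrightarrow> ?a"
  proof (rule LIMSEQ_I)
    fix r :: real assume "r > 0"
    \<comment> \<open>The total error is \<open>3 * \<delta>\<close> for the \<open>n\<close>-th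
      experiment, \<open>3 * \<delta>\<close> for the limit, and strictly less than
      \<open>\<delta>\<close> for the passage between them.\<close>
    define \<delta> where "\<delta> = r / 7"
    define k where "k = real (card I) + 1"
    define \<kappa> where "\<kappa> = \<delta> / k"
    have "\<delta> > 0" "k > 0" using \<open>r > 0\<close> by (auto simp: \<delta>_def k_def)
    hence "\<kappa> > 0" by (simp add: \<kappa>_def)
    obtain K where K: "K \<ge> 0" "\<And>x y. \<bar>f (restrict x I) - f (restrict y I)\<bar>
        \<le> \<delta> + \<kappa> * (\<Sum>a\<in>I. \<bar>x a\<bar>) + K * (\<Sum>a\<in>I. \<bar>x a - y a\<bar>)"
      using bounded_continuous_modulus[OF cont C I \<open>\<delta> > 0\<close> \<open>\<kappa> > 0\<close>] by blast
    \<comment> \<open>Chosen so that the \<open>K\<close> term costs at most \<open>\<delta>\<close>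
      at distance \<open>3 * \<epsilon>\<close> in each coordinate; \<open>K + 1\<close> and
      \<open>k\<close> are positive even if \<open>K\<close> is zero or \<open>I\<close> is
      empty.\<close>
    define \<epsilon> where "\<epsilon> = \<delta> / (K + 1) / k / 3"
    have "\<epsilon> > 0" using \<open>\<delta> > 0\<close> \<open>k > 0\<close> K(1) by (simp add: \<epsilon>_def)
    have small: "\<delta> + \<kappa> * card I + K * (card I * (3 * \<epsilon>)) \<le> 3 * \<delta>"
    proof -
      have "\<kappa> * card I \<le> \<kappa> * k" using \<open>\<kappa> > 0\<close> by (intro mult_left_mono) (auto simp: k_def)
      also have "\<dots> = \<delta>" using \<open>k > 0\<close> by (simp add: \<kappa>_def)
      finally have 1: "\<kappa> * card I \<le> \<delta>" .
      have "K * (card I * (3 * \<epsilon>)) \<le> (K + 1) * (k * (3 * \<epsilon>))"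
        using K(1) \<open>\<epsilon> > 0\<close> \<open>k > 0\<close> by (intro mult_mono) (auto simp: k_def)
      also have "\<dots> = \<delta>"
      proof -
        have "K + 1 \<noteq> 0" "k \<noteq> 0" using K(1) \<open>k > 0\<close> by auto
        thus ?thesis by (simp add: \<epsilon>_def)
      qed
      finally show ?thesis using 1 by linarith
    qed
    have "\<exists>M xs. M \<ge> 0 \<and> (\<integral>x. min (lik_ratio (P (p a)) (P o') x) M \<partial>P o') > 1 - \<epsilon> \<and> lim.admissible xs
        \<and> (\<integral>x. \<bar>min (lik_ratio (P (p a)) (P o') x) M - lim.tensor_val xs x\<bar> \<partial>P o') < \<epsilon>" for a
    proof -
      obtain M where M: "M \<ge> 0" "(\<integral>x. min (lik_ratio (P (p a)) (P o') x) M \<partial>P o') > 1 - \<epsilon>"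
        using lim.truncated_lik_ratio[OF \<open>\<epsilon> > 0\<close>] .
      have "integrable (P o') (\<lambda>x. min (lik_ratio (P (p a)) (P o') x) M)"
        using lim.integrable_L[of "p a"] lim.cD.integrable_const by (intro integrable_min)
      then obtain xs where "lim.admissible xs"
        "(\<integral>x. \<bar>min (lik_ratio (P (p a)) (P o') x) M - lim.tensor_val xs x\<bar> \<partial>P o') < \<epsilon>"
        using lim.tensor_dense[OF minimal gen _ \<open>\<epsilon> > 0\<close>] by blast
      with M show ?thesis by blast
    qed
    hence "\<forall>a. \<exists>M xs. M \<ge> 0 \<and> (\<integral>x. min (lik_ratio (P (p a)) (P o') x) M \<partial>P o') > 1 - \<epsilon> \<and> lim.admissible xs
        \<and> (\<integral>x. \<bar>min (lik_ratio (P (p a)) (P o') x) M - lim.tensor_val xs x\<bar> \<partial>P o') < \<epsilon>" ..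
    from choice[OF this] obtain M where
      "\<forall>a. \<exists>xs. M a \<ge> 0 \<and> (\<integral>x. min (lik_ratio (P (p a)) (P o') x) (M a) \<partial>P o') > 1 - \<epsilon> \<and> lim.admissible xs
        \<and> (\<integral>x. \<bar>min (lik_ratio (P (p a)) (P o') x) (M a) - lim.tensor_val xs x\<bar> \<partial>P o') < \<epsilon>" ..
    from choice[OF this] obtain xs where
      *: "\<forall>a. M a \<ge> 0 \<and> (\<integral>x. min (lik_ratio (P (p a)) (P o') x) (M a) \<partial>P o') > 1 - \<epsilon> \<and> lim.admissible (xs a)
        \<and> (\<integral>x. \<bar>min (lik_ratio (P (p a)) (P o') x) (M a) - lim.tensor_val (xs a) x\<bar> \<partial>P o') < \<epsilon>" ..
    have M: "M a \<ge> 0" "(\<integral>x. min (lik_ratio (P (p a)) (P o') x) (M a) \<partial>P o') > 1 - \<epsilon>"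
      and adm: "lim.admissible (xs a)"
      and close: "(\<integral>x. \<bar>min (lik_ratio (P (p a)) (P o') x) (M a) - lim.tensor_val (xs a) x\<bar> \<partial>P o') < \<epsilon>" for a
      using * by auto
    have cyl: "\<forall>p\<in>set (xs a). cyl (range \<nu>) (fst p)" for a
      using adm[of a] by (auto simp: lim.admissible_def)
    \<comment> \<open>The events of all coordinates are collected before coding: one
      \<open>\<xi>\<close> for the whole vector is what gives joint convergence.\<close>
    let ?\<A> = "\<Union>a\<in>I. snd ` set (xs a)"
    have "?\<A> \<subseteq> sets D" using adm by (fastforce simp: lim.admissible_def)
    moreover have "finite ?\<A>" using I by auto
    ultimately obtain \<xi> :: "'a \<Rightarrow> real" where \<xi>: "\<xi> \<in> borel_measurable D" and fin: "finite (\<xi> ` space D)"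
      and sep: "\<forall>A\<in>?\<A>. \<forall>x\<in>space D. \<forall>y\<in>space D. \<xi> x = \<xi> y \<longrightarrow> (x \<in> A \<longleftrightarrow> y \<in> A)"
      using encode_events[of ?\<A> D] by blast
    have "\<exists>\<psi> :: real \<Rightarrow> real. continuous_on UNIV \<psi> \<and> (\<forall>z. \<bar>\<psi> z\<bar> \<le> 1)
        \<and> (A \<in> ?\<A> \<longrightarrow> (\<forall>x\<in>space D. \<psi> (\<xi> x) = indicator A x))" for A
    proof (cases "A \<in> ?\<A>")
      case True
      obtain \<psi> :: "real \<Rightarrow> real" where "continuous_on UNIV \<psi>" "\<And>z. \<bar>\<psi> z\<bar> \<le> 1"
        "\<And>x. x \<in> space D \<Longrightarrow> \<psi> (\<xi> x) = indicator A x"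
        using decode_event[OF fin sep[rule_format, OF True]] by blast
      thus ?thesis by blast
    next
      case False
      \<comment> \<open>A default for the other events, so that \<open>\<psi> A\<close> is
        continuous and bounded by one for every \<open>A\<close>.\<close>
      thus ?thesis by (intro exI[of _ "\<lambda>_. 0"]) auto
    qed
    hence "\<forall>A. \<exists>\<psi> :: real \<Rightarrow> real. continuous_on UNIV \<psi> \<and> (\<forall>z. \<bar>\<psi> z\<bar> \<le> 1)
        \<and> (A \<in> ?\<A> \<longrightarrow> (\<forall>x\<in>space D. \<psi> (\<xi> x) = indicator A x))" ..
    from choice[OF this] obtain \<psi> :: "'a set \<Rightarrow> real \<Rightarrow> real" where
      **: "\<forall>A. continuous_on UNIV (\<psi> A) \<and> (\<forall>z. \<bar>\<psi> A z\<bar> \<le> 1)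
        \<and> (A \<in> ?\<A> \<longrightarrow> (\<forall>x\<in>space D. \<psi> A (\<xi> x) = indicator A x))" ..
    have \<psi>: "\<And>A. continuous_on UNIV (\<psi> A)" "\<And>A z. \<bar>\<psi> A z\<bar> \<le> 1"
      and dec: "\<And>A x. A \<in> ?\<A> \<Longrightarrow> x \<in> space D \<Longrightarrow> \<psi> A (\<xi> x) = indicator A x"
      using ** by blast+
    obtain \<xi>n where \<xi>n: "\<And>n. \<xi>n n \<in> borel_measurable (Dn n)" and rv: "rv_converges_weakly Pn P o' \<xi>n \<xi>"
      using conv \<xi> unfolding sigma_field_converges_weakly_def by blast
    \<comment> \<open>The coefficients are those of the limit, so that \<open>H\<close> does not
      change with \<open>n\<close>.\<close>
    define H where "H z a = tensor_sum (\<lambda>\<Phi>. \<integral>y. \<Phi> (lim.R y) \<partial>P o') (\<lambda>A. \<psi> A z) (xs a)" for z a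
    have val: "lim.tensor_val (xs a) x = tensor_sum (\<lambda>\<Phi>. \<Phi> (lim.R x)) (\<lambda>A. \<psi> A (\<xi> x)) (xs a)"
      if "a \<in> I" "x \<in> space B" for a x
      unfolding lim.tensor_val_def
    proof (rule tensor_sum_cong)
      fix \<Phi> A assume "(\<Phi>, A) \<in> set (xs a)"
      hence "A \<in> ?\<A>" using that(1) by force
      thus "\<Phi> (lim.R x) * indicator A x = \<Phi> (lim.R x) * \<psi> A (\<xi> x)"
        using dec that(2) lim.D_sub(2) by simp
    qed
    have close': "(\<integral>x. \<bar>min (lik_ratio (P (p a)) (P o') x) (M a)
        - tensor_sum (\<lambda>\<Phi>. \<Phi> (lim.R x)) (\<lambda>A. \<psi> A (\<xi> x)) (xs a)\<bar> \<partial>P o') < \<epsilon>" if "a \<in> I" for a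
    proof -
      have "(\<integral>x. \<bar>min (lik_ratio (P (p a)) (P o') x) (M a)
          - tensor_sum (\<lambda>\<Phi>. \<Phi> (lim.R x)) (\<lambda>A. \<psi> A (\<xi> x)) (xs a)\<bar> \<partial>P o')
        = (\<integral>x. \<bar>min (lik_ratio (P (p a)) (P o') x) (M a) - lim.tensor_val (xs a) x\<bar> \<partial>P o')"
        by (rule Bochner_Integration.integral_cong) (auto simp: val[OF that])
      thus ?thesis using close[of a] by simp
    qed
    have lim_close: "\<bar>?a - (\<integral>x. f (restrict (H (\<xi> x)) I) \<partial>P o')\<bar> \<le> 3 * \<delta>"
    proof -
      interpret prob_space "P o'" by (rule lim.prob_space_P)
      have "\<bar>?a - (\<integral>x. f (restrict (H (\<xi> x)) I) \<partial>P o')\<bar> \<le> \<delta> + \<kappa> * card I + K * (card I * (3 * \<epsilon>))"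
      proof (rule expectation_modulus[OF cont C K(2)])
        fix a assume "a \<in> I"
        have \<psi>m: "(\<lambda>x. \<psi> A (\<xi> x)) \<in> borel_measurable D" for A
          by (rule measurable_compose[OF \<xi> borel_measurable_continuous_onI[OF \<psi>(1)]])
        have "\<exists>C. \<forall>x\<in>space B. \<bar>\<psi> A (\<xi> x)\<bar> \<le> C" for A using \<psi>(2) by blast
        note tint = lim.cond_exp_tensor_sum(1)[of "xs a" "\<lambda>x A. \<psi> A (\<xi> x)", OF cyl \<psi>m this]
        have "(\<integral>x. \<bar>?X x a - H (\<xi> x) a\<bar> \<partial>P o') \<le> 2 * \<epsilon>"
          using lim.cond_lik_ratio_dist[of "xs a" \<psi> \<xi> "p a", OF cyl \<psi> \<xi>]
            lim.lik_ratio_truncation[OF tint M(2) close'[OF \<open>a \<in> I\<close>]]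
          unfolding H_def by linarith
        thus "(\<integral>x. \<bar>?X x a - H (\<xi> x) a\<bar> \<partial>P o') \<le> 3 * \<epsilon>" using \<open>\<epsilon> > 0\<close> by linarith
        show "integrable (P o') (\<lambda>x. ?X x a)" by (rule lim.cond_lik_ratio_integrable)
        show "(\<integral>x. \<bar>?X x a\<bar> \<partial>P o') \<le> 1" by (simp add: lim.cond_lik_ratio_abs)
        show "integrable (P o') (\<lambda>x. H (\<xi> x) a)"
          unfolding H_def by (rule lim.integrable_tensor[OF \<psi> \<xi>])
      qed (use \<open>\<kappa> > 0\<close> K(1) in auto)
      with small show ?thesis by linarith
    qed
    have "\<forall>\<^sub>F n in sequentially. \<forall>a\<in>I. (\<integral>x. \<bar>?Xn n x a - H (\<xi>n n x) a\<bar> \<partial>Pn n o') \<le> 3 * \<epsilon>"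
      unfolding H_def
      by (intro eventually_ball_finite[OF I] ballI cond_lik_ratio_close[OF rv \<xi>n cyl \<psi> M close'])
    moreover have "\<forall>\<^sub>F n in sequentially. \<bar>(\<integral>x. f (restrict (H (\<xi>n n x)) I) \<partial>Pn n o')
        - (\<integral>x. f (restrict (H (\<xi> x)) I) \<partial>P o')\<bar> < \<delta>"
    proof -
      have cH: "continuous_on UNIV (\<lambda>q :: ('i \<Rightarrow> real) \<times> real. restrict (H (snd q)) I)"
      proof (rule continuous_on_coordinatewise_then_product)
        fix a
        have "continuous_on UNIV (\<lambda>q :: ('i \<Rightarrow> real) \<times> real. H (snd q) a)"
          unfolding H_def
          by (intro continuous_on_tensor_sum continuous_on_const continuous_on_compose2[OF \<psi>(1)]
              continuous_on_snd continuous_on_id) auto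
        thus "continuous_on UNIV (\<lambda>q :: ('i \<Rightarrow> real) \<times> real. restrict (H (snd q)) I a)"
          by (cases "a \<in> I") simp_all
      qed
      have "(\<lambda>n. \<integral>x. f (restrict (H (\<xi>n n x)) I) \<partial>Pn n o') \<longlonglongrightarrow> (\<integral>x. f (restrict (H (\<xi> x)) I) \<partial>P o')"
      \<comment> \<open>The test function depends on the second component alone, hence the empty
        \<open>J\<close>.\<close>
      proof (rule test_function_converges[OF rv, where F = "\<lambda>q. f (restrict (H (snd q)) I)" and C = C and J = "{}", simplified])
        show "continuous_on UNIV (\<lambda>q :: ('i \<Rightarrow> real) \<times> real. f (restrict (H (snd q)) I))"
          by (rule continuous_on_compose2[OF cont cH]) auto
      qed (rule C)
      from LIMSEQ_D[OF this \<open>\<delta> > 0\<close>] show ?thesis by (simp add: eventually_sequentially)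
    qed
    ultimately have "\<forall>\<^sub>F n in sequentially. \<bar>?an n - ?a\<bar> < r"
    proof eventually_elim
      fix n
      assume n1: "\<forall>a\<in>I. (\<integral>x. \<bar>?Xn n x a - H (\<xi>n n x) a\<bar> \<partial>Pn n o') \<le> 3 * \<epsilon>"
        and n2: "\<bar>(\<integral>x. f (restrict (H (\<xi>n n x)) I) \<partial>Pn n o') - (\<integral>x. f (restrict (H (\<xi> x)) I) \<partial>P o')\<bar> < \<delta>"
      interpret prob_space "Pn n o'" by (rule E.prob_space_P)
      have "\<bar>?an n - (\<integral>x. f (restrict (H (\<xi>n n x)) I) \<partial>Pn n o')\<bar> \<le> \<delta> + \<kappa> * card I + K * (card I * (3 * \<epsilon>))"
      proof (rule expectation_modulus[OF cont C K(2)])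
        fix a assume "a \<in> I"
        thus "(\<integral>x. \<bar>?Xn n x a - H (\<xi>n n x) a\<bar> \<partial>Pn n o') \<le> 3 * \<epsilon>" using n1 by blast
        show "integrable (Pn n o') (\<lambda>x. ?Xn n x a)" by (rule E.cond_lik_ratio_integrable)
        show "(\<integral>x. \<bar>?Xn n x a\<bar> \<partial>Pn n o') \<le> 1" by (simp add: E.cond_lik_ratio_abs)
        show "integrable (Pn n o') (\<lambda>x. H (\<xi>n n x) a)"
          unfolding H_def by (rule E.integrable_tensor[OF \<psi> \<xi>n])
      qed (use \<open>\<kappa> > 0\<close> K(1) in auto)
      with small lim_close n2 \<open>r > 0\<close> show "\<bar>?an n - ?a\<bar> < r"
        unfolding \<delta>_def by linarith
    qed
    thus "\<exists>N. \<forall>n\<ge>N. norm (?an n - ?a) < r" by (simp add: eventually_sequentially)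
  qed
qed

end

theorem theorem2p1:
  fixes Bn :: "nat \<Rightarrow> 'b measure"
    and Pn :: "nat \<Rightarrow> (real ^ 'k) \<times> ('h :: {real_vector, topological_ab_group_add}) \<Rightarrow> 'b measure"
    and B :: "'a measure"
    and P :: "(real ^ 'k) \<times> 'h \<Rightarrow> 'a measure"
    and Sn Dn :: "nat \<Rightarrow> 'b measure"
    and S D :: "'a measure"
    and l1 l2 :: nat
    and \<tau> :: "nat \<Rightarrow> real ^ 'k"
    and \<eta> :: "nat \<Rightarrow> 'h"
  assumes nuisance_tvs: "continuous_on UNIV (\<lambda>(c :: real, h :: 'h). c *\<^sub>R h)"
    and nuisance_separable: "separable_space (euclidean :: 'h topology)"
    and nuisance_inf_dim: "\<nexists>H :: 'h set. finite H \<and> span H = UNIV"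
    and experiments: "\<And>n. is_experiment (Bn n) (Pn n)"
    and limit_experiment: "is_experiment B P"
    and Le_Cam: "Le_Cam_converges Pn P (0, 0)"
    and cg: "countably_generated B"
    and limit_suff: "minimal_sufficient B (\<lambda>h. P (0, h)) S"
    and limit_complete: "boundedly_complete B (\<lambda>h. P (0, h)) S"
    and limit_ancillary: "unique_maximal_ancillary B (\<lambda>h. P (0, h)) D"
    and limit_generate: "jointly_generate B S D"
    and suff: "\<And>n. minimal_sufficient (Bn n) (\<lambda>h. Pn n (0, h)) (Sn n)"
    and complete: "\<And>n. boundedly_complete (Bn n) (\<lambda>h. Pn n (0, h)) (Sn n)"
    and max_ancillary: "\<And>n. maximal_ancillary (Bn n) (\<lambda>h. Pn n (0, h)) (Dn n)"
    and generate: "\<And>n. jointly_generate (Bn n) (Sn n) (Dn n)"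
    and ancillary_converges: "sigma_field_converges_weakly Pn P (0, 0) Dn D"
  shows "converges_in_distribution
           (\<lambda>n. Pn n (0, 0))
           (\<lambda>n x. \<lambda>(i, j) \<in> {1..l1} \<times> {1..l2}.
              cond_lik_ratio (Pn n (\<tau> i, \<eta> j)) (Pn n (0, 0)) (Dn n) x)
           (P (0, 0))
           (\<lambda>x. \<lambda>(i, j) \<in> {1..l1} \<times> {1..l2}.
              cond_lik_ratio (P (\<tau> i, \<eta> j)) (P (0, 0)) D x)"
proof -
  \<comment> \<open>\<open>Pair 0\<close> embeds the nuisance space at parameter of interest zero,
    and its value at zero is the reference point.\<close>
  have lim: "nuisance_experiment B P (Pair 0) (0, 0) S D"
    using limit_experiment limit_suff limit_complete limit_ancillary
    by (auto simp: nuisance_experiment_def nuisance_experiment_axioms_def stat_experiment_def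
        minimal_sufficient_def unique_maximal_ancillary_def maximal_ancillary_def)
  have "nuisance_experiment (Bn n) (Pn n) (Pair 0) (0, 0) (Sn n) (Dn n)" for n
    using experiments[of n] suff[of n] complete[of n] max_ancillary[of n]
    by (auto simp: nuisance_experiment_def nuisance_experiment_axioms_def stat_experiment_def
        minimal_sufficient_def maximal_ancillary_def)
  with lim interpret nuisance_convergence B P "Pair 0" "(0, 0)" S D Bn Pn Sn Dn
    by (intro nuisance_convergence.intro nuisance_convergence_axioms.intro)
  have "finite ({1..l1} \<times> {1..l2})" by simp
  from cond_lik_ratio_converges[OF limit_suff limit_generate ancillary_converges this, of "\<lambda>(i, j). (\<tau> i, \<eta> j)"]
  show ?thesis by (simp add: case_prod_unfold)
qed

end
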